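(* Let $X$ be a real Banach space. The following are equivalent: (1) $X$ has the uniform strong diameter two property (USD2P). (2) There exists a free ultrafilter $\mathcal{U}$ over $\mathbb{N}$ such that $X_{\mathcal{U}}$ has the SD2P. (3) There exist a set $\Lambda$ and a countably incomplete ultrafilter $\mathcal{U}$ over $\Lambda$ such that $X_{\mathcal{U}}$ has the SD2P. (4) For every $n\in\mathbb{N}$ and $\varepsilon>0$, $\lim_{k\to\infty}D_k^{n,\varepsilon}(X)=0$; that is, given any $\delta>0$ there exists $m\in\mathbb{N}$ such that $D_m^{n,\varepsilon}(X)<\delta$. (5) For every $n\in\mathbb{N}$ and $\varepsilon>0$, $\lim_{k\to\infty}D_k^{n,\varepsilon+}(X)=0$; that is, given any $\delta>0$ there exists $m\in\mathbb{N}$ such that $D_m^{n,\varepsilon+}(X)<\delta$. (6) For any set $\Lambda$ and any countably incomplete ultrafilter $\mathcal{U}$ over $\Lambda$, the ultrapower $X_{\mathcal{U}}$ has the SD2P.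
   Context: $B_X$ is the closed unit ball of $X$, and $\mathbb{N}=\{1,2,\dots\}$. A slice of $B_X$ is a set $S(B_X,f,\alpha)=\{x\in B_X: f(x)>\sup f(B_X)-\alpha\}$ with $f\in X^*$, $\alpha>0$. A convex combination of slices of $B_X$ is a set $\sum_{i=1}^n\lambda_iS_i=\{\sum_{i=1}^n\lambda_i x_i: x_i\in S_i\}$ with $n\in\mathbb{N}$, $\lambda_i>0$, $\sum_{i=1}^n\lambda_i=1$ and each $S_i$ a slice of $B_X$. $X$ has the strong diameter two property (SD2P) if every convex combination of slices of $B_X$ has diameter $2$. An ultrafilter $\mathcal{U}$ over $\Lambda$ is countably incomplete if there is a countable family of members of $\mathcal{U}$ with empty intersection. The ultrapower is $X_{\mathcal{U}}=\ell_\infty(\Lambda,X)/c_{0,\mathcal{U}}(\Lambda,X)$ with the quotient norm, where $\ell_\infty(\Lambda,X)$ is the space of bounded functions $f:\Lambda\to X$ (sup norm) and $c_{0,\mathcal{U}}(\Lambda,X)=\{f\in\ell_\infty(\Lambda,X):\lim_{\mathcal{U}}\|f(\lambda)\|=0\}$. $X$ has the uniform strong diameter two property (USD2P) if $X_{\mathcal{U}}$ has the SD2P for every free ultrafilter $\mathcal{U}$ over $\mathbb{N}$. $\ell_\infty^n(X)$ is $X^n$ with the norm $\|(z_1,\dots,z_n)\|_\infty=\max_i\|z_i\|$. For a set $C$, $\mathrm{co}_m(C)$ is the set of all convex combinations of at most $m$ elements of $C$. For $n,m\in\mathbb{N}$ and $\varepsilon,\alpha>0$ put $$C_m^{n,\varepsilon,\alpha}(X)=\mathrm{co}_m\left(\left\{z\in\ell_\infty^n(X):\|z\|_\infty\le\alpha,\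 \frac1n\left\|\sum_{i=1}^n z_i\right\|>1-\varepsilon\right\}\right),$$ $$D_m^{n,\varepsilon,\alpha}(X)=\sup_{z\in B_{\ell_\infty^n(X)}}d\left(z,C_m^{n,\varepsilon,\alpha}(X)\right),$$ where $d$ is the distance in $\ell_\infty^n(X)$ (the distance to the empty set being $+\infty$). Write $D_m^{n,\varepsilon}(X)=D_m^{n,\varepsilon,1}(X)$ and $D_m^{n,\varepsilon+}(X)=D_m^{n,\varepsilon,1+\varepsilon}(X)$. *)

theory Defs
  imports "HOL-Analysis.Analysis" "HOL-Algebra.Module" "HOL-Algebra.AbelCoset"
begin

section \<open>Real normed spaces given by a carrier\<close>

text \<open>
  An ultrapower depends on the ultrafilter and \<open>l\<^sub>\<infinity>\<^sup>n(X)\<close> depends on \<open>n\<close>, so neither can be a type.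
  Both are represented as HOL-Algebra modules over the reals with a norm. As for any
  HOL-Algebra module, the fields \<open>mult\<close> and \<open>one\<close> inherited from the ring record are irrelevant.
\<close>

record 'v nspace = "(real, 'v) module" +
  vnorm :: "'v \<Rightarrow> real"

definition vball :: "('v, 'm) nspace_scheme \<Rightarrow> 'v set" where
  "vball V = {x \<in> carrier V. vnorm V x \<le> 1}"

text \<open>Functionals are total HOL functions; only their values on the carrier matter.\<close>

definition dual :: "('v, 'm) nspace_scheme \<Rightarrow> ('v \<Rightarrow> real) set" where
  "dual V = {f.
     (\<forall>x\<in>carrier V. \<forall>y\<in>carrier V. f (x \<oplus>\<^bsub>V\<^esub> y) = f x + f y) \<and>
     (\<forall>c. \<forall>x\<in>carrier V. f (c \<odot>\<^bsub>V\<^esub> x) = c * f x) \<and>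
     (\<exists>K. \<forall>x\<in>carrier V. \<bar>f x\<bar> \<le> K * vnorm V x)}"

text \<open>Extended real values, so that unbounded sets need no convention.\<close>

definition vdiameter :: "('v, 'm) nspace_scheme \<Rightarrow> 'v set \<Rightarrow> ereal" where
  "vdiameter V C = (SUP x\<in>C. SUP y\<in>C. ereal (vnorm V (x \<ominus>\<^bsub>V\<^esub> y)))"

text \<open>The distance to the empty set is \<open>\<infinity>\<close>, unlike for the library's \<open>infdist\<close>.\<close>

definition vsetdist :: "('v, 'm) nspace_scheme \<Rightarrow> 'v \<Rightarrow> 'v set \<Rightarrow> ereal" where
  "vsetdist V x C = (INF y\<in>C. ereal (vnorm V (x \<ominus>\<^bsub>V\<^esub> y)))"


section \<open>The strong diameter two property\<close>

definition slice :: "('v, 'm) nspace_scheme \<Rightarrow> ('v \<Rightarrow> real) \<Rightarrow> real \<Rightarrow> 'v set" where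
  "slice V f \<alpha> = {x \<in> vball V. f x > (SUP y\<in>vball V. f y) - \<alpha>}"

definition is_slice :: "('v, 'm) nspace_scheme \<Rightarrow> 'v set \<Rightarrow> bool" where
  "is_slice V S \<longleftrightarrow> (\<exists>f\<in>dual V. \<exists>\<alpha>>0. S = slice V f \<alpha>)"

definition convex_comb_of_slices :: "('v, 'm) nspace_scheme \<Rightarrow> 'v set \<Rightarrow> bool" where
  "convex_comb_of_slices V C \<longleftrightarrow>
     (\<exists>(n::nat) c S. n \<ge> 1 \<and>
        (\<forall>i\<in>{1..n}. c i > 0 \<and> is_slice V (S i)) \<and> (\<Sum>i\<in>{1..n}. c i) = 1 \<and>
        C = {\<Oplus>\<^bsub>V\<^esub>i\<in>{1..n}. c i \<odot>\<^bsub>V\<^esub> x i | x. \<forall>i\<in>{1..n}. x i \<in> S i})"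

definition SD2P :: "('v, 'm) nspace_scheme \<Rightarrow> bool" where
  "SD2P V \<longleftrightarrow> (\<forall>C. convex_comb_of_slices V C \<longrightarrow> vdiameter V C = 2)"


section \<open>Bounded functions, quotients and ultrapowers\<close>

definition linf :: "'i set \<Rightarrow> ('i \<Rightarrow> 'a::real_normed_vector) nspace" where
  "linf \<Lambda> = \<lparr>carrier = {f \<in> extensional \<Lambda>. bounded (f ` \<Lambda>)},
     mult = undefined, one = undefined,
     zero = (\<lambda>i\<in>\<Lambda>. 0), add = (\<lambda>f g. \<lambda>i\<in>\<Lambda>. f i + g i),
     smult = (\<lambda>c f. \<lambda>i\<in>\<Lambda>. c *\<^sub>R f i),
     vnorm = (\<lambda>f. SUP i\<in>\<Lambda>. norm (f i))\<rparr>"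

text \<open>
  The elements are the cosets of \<open>M\<close>. Adding \<open>M\<close> in the scalar multiplication makes
  \<open>c \<odot> (x + M) = c \<odot> x + M\<close> hold for \<open>c = 0\<close> as well.
\<close>

definition nquotient :: "('v, 'm) nspace_scheme \<Rightarrow> 'v set \<Rightarrow> 'v set nspace" where
  "nquotient V M = \<lparr>carrier = a_rcosets\<^bsub>V\<^esub> M,
     mult = undefined, one = undefined,
     zero = M, add = set_add V,
     smult = (\<lambda>c A. set_add V M ((\<lambda>x. c \<odot>\<^bsub>V\<^esub> x) ` A)),
     vnorm = (\<lambda>A. INF x\<in>A. vnorm V x)\<rparr>"

text \<open>
  A filter over the set \<open>\<Lambda>\<close> is a library filter below \<open>principal \<Lambda>\<close>;
  its members are the sets \<open>A \<subseteq> \<Lambda>\<close> in which it eventually lies.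
\<close>

definition filter_members :: "'i set \<Rightarrow> 'i filter \<Rightarrow> 'i set set" where
  "filter_members \<Lambda> U = {A. A \<subseteq> \<Lambda> \<and> (\<forall>\<^sub>F i in U. i \<in> A)}"

definition ultrafilter_over :: "'i set \<Rightarrow> 'i filter \<Rightarrow> bool" where
  "ultrafilter_over \<Lambda> U \<longleftrightarrow> U \<noteq> bot \<and> U \<le> principal \<Lambda> \<and>
     (\<forall>A\<subseteq>\<Lambda>. A \<in> filter_members \<Lambda> U \<or> \<Lambda> - A \<in> filter_members \<Lambda> U)"

definition free_ultrafilter_over :: "'i set \<Rightarrow> 'i filter \<Rightarrow> bool" where
  "free_ultrafilter_over \<Lambda> U \<longleftrightarrow>
     ultrafilter_over \<Lambda> U \<and> \<Inter>(filter_members \<Lambda> U) = {}"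

definition countably_incomplete_ultrafilter_over :: "'i set \<Rightarrow> 'i filter \<Rightarrow> bool" where
  "countably_incomplete_ultrafilter_over \<Lambda> U \<longleftrightarrow> ultrafilter_over \<Lambda> U \<and>
     (\<exists>\<A>\<subseteq>filter_members \<Lambda> U. countable \<A> \<and> \<Inter>\<A> = {})"

definition c0U :: "'i set \<Rightarrow> 'i filter \<Rightarrow> ('i \<Rightarrow> 'a::real_normed_vector) set" where
  "c0U \<Lambda> U = {f \<in> carrier (linf \<Lambda>). ((\<lambda>i. norm (f i)) \<longlongrightarrow> 0) U}"

text \<open>The \<open>itself\<close> argument is the space \<open>X\<close>.\<close>

definition ultrapower ::
    "'a::real_normed_vector itself \<Rightarrow> 'i set \<Rightarrow> 'i filter \<Rightarrow> ('i \<Rightarrow> 'a) set nspace" where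
  "ultrapower X \<Lambda> U = nquotient (linf \<Lambda>) (c0U \<Lambda> U)"

definition USD2P :: "'a::real_normed_vector itself \<Rightarrow> bool" where
  "USD2P X \<longleftrightarrow> (\<forall>U. free_ultrafilter_over {1::nat..} U \<longrightarrow> SD2P (ultrapower X {1..} U))"


section \<open>The sets \<open>C\<close> and the quantities \<open>D\<close>\<close>

definition convex_combs_upto :: "('v, 'm) nspace_scheme \<Rightarrow> nat \<Rightarrow> 'v set \<Rightarrow> 'v set" where
  "convex_combs_upto V m A =
     {\<Oplus>\<^bsub>V\<^esub>j\<in>{1..k}. c j \<odot>\<^bsub>V\<^esub> x j | k (c :: nat \<Rightarrow> real) x.
        1 \<le> k \<and> k \<le> m \<and> (\<forall>j\<in>{1..k}. c j \<ge> 0 \<and> x j \<in> A) \<and> (\<Sum>j\<in>{1..k}. c j) = 1}"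

text \<open>
  \<open>l\<^sub>\<infinity>\<^sup>n(X)\<close> is \<open>linf {1..n}\<close>: on a nonempty finite index set every function is bounded
  and the supremum is the maximum.
\<close>

definition Cset :: "nat \<Rightarrow> nat \<Rightarrow> real \<Rightarrow> real \<Rightarrow> (nat \<Rightarrow> 'a::real_normed_vector) set" where
  "Cset n m \<epsilon> \<alpha> = convex_combs_upto (linf {1..n}) m
     {z \<in> carrier (linf {1..n}). vnorm (linf {1..n}) z \<le> \<alpha> \<and>
        (1 / real n) * norm (\<Sum>i\<in>{1..n}. z i) > 1 - \<epsilon>}"

definition Dparam ::
    "'a::real_normed_vector itself \<Rightarrow> nat \<Rightarrow> nat \<Rightarrow> real \<Rightarrow> real \<Rightarrow> ereal" where
  "Dparam X n m \<epsilon> \<alpha> =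
     (SUP z \<in> vball (linf {1..n}). vsetdist (linf {1..n}) (z :: nat \<Rightarrow> 'a) (Cset n m \<epsilon> \<alpha>))"

definition Dunit :: "'a::real_normed_vector itself \<Rightarrow> nat \<Rightarrow> nat \<Rightarrow> real \<Rightarrow> ereal" where
  "Dunit X n m \<epsilon> = Dparam X n m \<epsilon> 1"

definition Dplus :: "'a::real_normed_vector itself \<Rightarrow> nat \<Rightarrow> nat \<Rightarrow> real \<Rightarrow> ereal" where
  "Dplus X n m \<epsilon> = Dparam X n m \<epsilon> (1 + \<epsilon>)"

end

theory Submission
  imports Defs
begin

text \<open>
  A space \<open>V\<close> has the SD2P iff for any \<open>n\<close> slices of the ball and any \<open>\<epsilon> > 0\<close> there are points
  \<open>w\<^sub>i\<close> of the slices with \<open>\<parallel>\<Sum>w\<^sub>i\<parallel> > n (1 - \<epsilon>)\<close>. By Hahn-Banach separation in \<open>V\<^sup>n\<close>, this says that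
  the convex hull of the tuples in the ball with such a large sum is dense in the ball of \<open>V\<^sup>n\<close>.
  If \<open>V\<close> is an ultrapower of \<open>X\<close> with respect to a countably incomplete ultrafilter and the
  quantities \<open>D\<^sub>m\<close> did not tend to zero, a tuple glued from witnesses for larger and larger \<open>m\<close>
  could not be approximated by convex combinations of finitely many such tuples. Conversely,
  approximations in \<open>X\<close> by a bounded number of terms pass to any ultrapower, since the
  coefficients converge along the ultrafilter.
\<close>

section \<open>Ultrafilters\<close>

text \<open>The estimate that passes between X and its ultrapower is uniform: one number m of terms
  must serve all tuples of the ball. Approximations chosen in X index by index have weights that
  vary with the index; a fixed m confines them to a compact set, so they can be replaced by constant
  limits. The radius 1 + \<epsilon> is harmless, since dividing by it changes the norm of the sum
  and the values of functionals only slightly.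

  Slices concern n functionals separately, while separation yields a single functional on tuples.
  The two views agree because no functional exceeds its supremum on the ball: if the sum of the n
  values is almost the sum of the suprema, each value is almost its own supremum.

  Calculations use bounded functions on \<Lambda> with the limit of the norms as seminorm; cosets
  enter only as images of such functions. Hahn-Banach is accordingly stated for a set of functions,
  a sublinear bound and a cone of lower bounds, so that neither the quotient nor the space of tuples
  has to be a type.\<close>

lemma ex_ultrafilter_le:
  assumes "F \<noteq> bot"
  shows "\<exists>U\<le>F. U \<noteq> bot \<and> (\<forall>P. eventually P U \<or> (\<forall>\<^sub>F x in U. \<not> P x))"
proof -
  define A where "A = {G. G \<le> F \<and> G \<noteq> bot}"
  \<comment> \<open>The order is reversed: a maximal element for \<open>R\<close> is a finest
    nontrivial filter.\<close>
  define R where "R = (\<lambda>a b. b \<le> (a :: 'a filter))"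
  have po: "partial_order_on A (relation_of R A)"
    by (auto simp: partial_order_on_def preorder_on_def refl_on_def trans_def antisym_def
        relation_of_def R_def)
  have "\<exists>m\<in>A. \<forall>a\<in>A. R m a \<longrightarrow> a = m"
  proof (rule predicate_Zorn[OF po])
    fix C assume C: "C \<in> Chains (relation_of R A)"
    then have CA: "C \<subseteq> A" and tot: "a \<le> b \<or> b \<le> a" if "a \<in> C" "b \<in> C" for a b
      using that by (auto simp: Chains_def relation_of_def R_def)
    show "\<exists>u\<in>A. \<forall>a\<in>C. R a u"
    proof (cases "C = {}")
      case True
      then show ?thesis using assms by (auto simp: A_def)
    next
      case False
      then obtain G where G: "G \<in> C" by auto
      have CA: "C \<subseteq> A" using CA[OF G G] .
      \<comment> \<open>A chain is directed downwards, so what holds eventually for its infimum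
        holds eventually for one of its members; hence \<open>False\<close> does not.\<close>
      have "eventually P (Inf C) \<longleftrightarrow> (\<exists>b\<in>C. eventually P b)" for P
      proof (rule eventually_Inf_base)
        show "\<exists>x\<in>C. x \<le> inf F G" if "F \<in> C" "G \<in> C" for F G
          using tot[OF that] that by auto
      qed (use False in simp)
      then have "Inf C \<noteq> bot"
        using CA by (auto simp: trivial_limit_def A_def)
      moreover have "Inf C \<le> F"
        using G CA by (auto simp: A_def intro: Inf_lower2)
      ultimately show ?thesis
        by (auto simp: A_def R_def intro!: bexI[of _ "Inf C"] Inf_lower)
    qed
  qed
  then obtain U where U: "U \<in> A" and min: "\<And>G. G \<in> A \<Longrightarrow> G \<le> U \<Longrightarrow> G = U"
    by (auto simp: R_def)
  have "eventually P U \<or> (\<forall>\<^sub>F x in U. \<not> P x)" for P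
  proof (cases "eventually P U")
    case False
    \<comment> \<open>If \<open>P\<close> is not eventual, conditioning on its failure keeps the
      filter nontrivial; minimality of \<open>U\<close> then makes the failure itself
      eventual.\<close>
    let ?G = "inf U (principal {x. \<not> P x})"
    have "?G \<noteq> bot"
      using False by (auto simp: trivial_limit_def eventually_inf_principal elim: eventually_mono)
    then have "?G \<in> A" using U by (auto simp: A_def intro: le_infI1)
    then have "?G = U" by (intro min) auto
    moreover have "\<forall>\<^sub>F x in ?G. \<not> P x" by (simp add: eventually_inf_principal)
    ultimately show ?thesis by simp
  qed simp
  then show ?thesis using U by (auto simp: A_def)
qed

lemma ex_ultrafilter_over_le:
  assumes "F \<noteq> bot" "F \<le> principal \<Lambda>"
  shows "\<exists>U\<le>F. ultrafilter_over \<Lambda> U"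
proof -
  obtain U where U: "U \<le> F" "U \<noteq> bot" "\<And>P. eventually P U \<or> (\<forall>\<^sub>F x in U. \<not> P x)"
    using ex_ultrafilter_le[OF assms(1)] by auto
  have le: "U \<le> principal \<Lambda>" using U(1) assms(2) by (rule order_trans)
  then have "\<forall>\<^sub>F x in U. x \<in> \<Lambda>" by (simp add: le_principal)
  then have "A \<in> filter_members \<Lambda> U \<or> \<Lambda> - A \<in> filter_members \<Lambda> U" if "A \<subseteq> \<Lambda>" for A
    using U(3)[of "\<lambda>x. x \<in> A"] that
    by (auto simp: filter_members_def intro: eventually_elim2)
  then show ?thesis using U le by (auto simp: ultrafilter_over_def)
qed

lemma free_ultrafilter_le_sequentially:
  assumes "ultrafilter_over {1..} U" "U \<le> sequentially"
  shows "free_ultrafilter_over {1..} U"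
proof -
  have "{n<..} \<in> filter_members {1..} U" for n :: nat
    using filter_leD[OF assms(2) eventually_gt_at_top[of n]] by (auto simp: filter_members_def)
  then have "\<Inter> (filter_members {1..} U) = {}" by blast
  then show ?thesis using assms by (simp add: free_ultrafilter_over_def)
qed

lemma ex_free_ultrafilter_over_nat: "\<exists>U. free_ultrafilter_over {1::nat..} U"
proof -
  have "\<exists>U\<le>sequentially. ultrafilter_over {1::nat..} U"
    by (rule ex_ultrafilter_over_le) (auto simp: le_principal eventually_ge_at_top)
  then show ?thesis using free_ultrafilter_le_sequentially by blast
qed

lemma free_ultrafilter_over_imp_countably_incomplete:
  assumes "free_ultrafilter_over \<Lambda> U" "countable \<Lambda>"
  shows "countably_incomplete_ultrafilter_over \<Lambda> U"
proof -
  have U: "ultrafilter_over \<Lambda> U" and free: "\<Inter> (filter_members \<Lambda> U) = {}"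
    using assms by (auto simp: free_ultrafilter_over_def)
  then have "\<forall>x. \<exists>A\<in>filter_members \<Lambda> U. x \<notin> A" by blast
  then obtain A where A: "\<And>x. A x \<in> filter_members \<Lambda> U" "\<And>x. x \<notin> A x" by metis
  have sub: "filter_members \<Lambda> U \<subseteq> Pow \<Lambda>" by (auto simp: filter_members_def)
  \<comment> \<open>Adding \<open>\<Lambda>\<close> confines a common point x to
    \<open>\<Lambda>\<close>, where the member \<open>A x\<close> excludes it.\<close>
  have "\<Inter> (insert \<Lambda> (A ` \<Lambda>)) = {}" using A(2) by auto
  moreover have "\<Lambda> \<in> filter_members \<Lambda> U"
    using U by (simp add: filter_members_def ultrafilter_over_def le_principal)
  ultimately show ?thesis
    using U A(1) assms(2) unfolding countably_incomplete_ultrafilter_over_def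
    by (intro conjI exI[of _ "insert \<Lambda> (A ` \<Lambda>)"]) auto
qed

text \<open>The tails of \<open>nat\<close> are transported along an injection. This supplies, in
  any infinite type, the ultrafilter whose existence (3) asserts and to which (6) can be
  applied.\<close>

lemma ex_countably_incomplete_ultrafilter_over:
  assumes "infinite (UNIV :: 'i set)"
  shows "\<exists>(\<Lambda> :: 'i set) U. countably_incomplete_ultrafilter_over \<Lambda> U"
proof -
  obtain g :: "nat \<Rightarrow> 'i" where g: "inj g"
    using infinite_countable_subset[OF assms] by auto
  let ?F = "filtermap g sequentially"
  obtain U where U: "U \<le> ?F" "ultrafilter_over (range g) U"
    using ex_ultrafilter_over_le[of ?F "range g"]
    by (auto simp: filtermap_bot_iff le_principal eventually_filtermap)
  have "g ` {n<..} \<in> filter_members (range g) U" for n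
  proof -
    have "\<forall>\<^sub>F k in sequentially. g k \<in> g ` {n<..}"
      by (rule eventually_mono[OF eventually_gt_at_top[of n]]) simp
    then have "\<forall>\<^sub>F x in ?F. x \<in> g ` {n<..}" by (simp add: eventually_filtermap)
    then show ?thesis using filter_leD[OF U(1)] by (auto simp: filter_members_def)
  qed
  moreover have "(\<Inter>n. g ` {n<..}) = {}"
  proof -
    have "g n \<notin> g ` {n<..}" for n using g by (auto simp: inj_def)
    then show ?thesis by blast
  qed
  ultimately show ?thesis
    using U(2) unfolding countably_incomplete_ultrafilter_over_def
    by (intro exI conjI exI[of _ "range (\<lambda>n. g ` {n<..})"]) auto
qed

section \<open>Limits along a fixed ultrafilter\<close>

locale ultrafilter_on =
  fixes \<Lambda> :: "'i set" and U :: "'i filter"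
  assumes ultrafilter: "ultrafilter_over \<Lambda> U"
begin

lemma nontrivial [simp]: "U \<noteq> bot" and le_principal_base: "U \<le> principal \<Lambda>"
  using ultrafilter by (auto simp: ultrafilter_over_def)

lemma eventually_base: "\<forall>\<^sub>F i in U. i \<in> \<Lambda>"
  using le_principal_base by (simp add: le_principal)

lemma base_nonempty: "\<Lambda> \<noteq> {}"
  using eventually_base nontrivial by (auto simp: trivial_limit_def)

lemma eventually_on_base: "(\<And>i. i \<in> \<Lambda> \<Longrightarrow> P i) \<Longrightarrow> eventually P U"
  using eventually_base by (auto elim: eventually_mono)

lemma eventually_or_not: "eventually P U \<or> (\<forall>\<^sub>F i in U. \<not> P i)"
proof -
  let ?A = "{i \<in> \<Lambda>. P i}"
  have "?A \<in> filter_members \<Lambda> U \<or> \<Lambda> - ?A \<in> filter_members \<Lambda> U"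
    using ultrafilter by (auto simp: ultrafilter_over_def)
  then have "(\<forall>\<^sub>F i in U. i \<in> ?A) \<or> (\<forall>\<^sub>F i in U. i \<in> \<Lambda> - ?A)"
    by (simp add: filter_members_def)
  then show ?thesis
    by (rule disj_forward; elim eventually_mono) auto
qed

text \<open>Compactness provides a cluster point of the image filter; since the ultrafilter decides
  each neighbourhood, the cluster point is a limit.\<close>

lemma compact_limit:
  fixes g :: "'i \<Rightarrow> 'b::topological_space"
  assumes "compact K" "\<And>i. i \<in> \<Lambda> \<Longrightarrow> g i \<in> K"
  shows "\<exists>l\<in>K. (g \<longlongrightarrow> l) U"
proof -
  have "\<forall>\<^sub>F i in U. g i \<in> K" by (rule eventually_on_base) (rule assms)
  then obtain l where l: "l \<in> K" "inf (nhds l) (filtermap g U) \<noteq> bot"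
    using assms(1) unfolding compact_filter
    by (auto simp: eventually_filtermap filtermap_bot_iff dest!: spec[of _ "filtermap g U"])
  have "eventually (\<lambda>i. g i \<in> S) U" if S: "open S" "l \<in> S" for S
  proof (rule ccontr)
    assume "\<not> eventually (\<lambda>i. g i \<in> S) U"
    then have "\<forall>\<^sub>F x in filtermap g U. x \<notin> S"
      using eventually_or_not[of "\<lambda>i. g i \<in> S"] by (simp add: eventually_filtermap)
    moreover have "\<forall>\<^sub>F x in nhds l. x \<in> S" using S by (simp add: eventually_nhds_in_open)
    ultimately have "eventually (\<lambda>_. False) (inf (nhds l) (filtermap g U))"
      unfolding eventually_inf by blast
    then show False using l(2) by (simp add: trivial_limit_def)
  qed
  then have "(g \<longlongrightarrow> l) U" by (rule topological_tendstoI)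
  then show ?thesis using l(1) by auto
qed

end


section \<open>A Hahn-Banach theorem for cones\<close>

definition fun_subspace :: "('k \<Rightarrow> 'a::real_vector) set \<Rightarrow> bool" where
  "fun_subspace S \<longleftrightarrow> (\<lambda>_. 0) \<in> S \<and>
     (\<forall>x\<in>S. \<forall>y\<in>S. (\<lambda>k. x k + y k) \<in> S) \<and> (\<forall>c. \<forall>x\<in>S. (\<lambda>k. c *\<^sub>R x k) \<in> S)"

definition sublinear_on :: "('k \<Rightarrow> 'a::real_vector) set \<Rightarrow> (('k \<Rightarrow> 'a) \<Rightarrow> real) \<Rightarrow> bool" where
  "sublinear_on S p \<longleftrightarrow>
     (\<forall>x\<in>S. \<forall>y\<in>S. p (\<lambda>k. x k + y k) \<le> p x + p y) \<and>
     (\<forall>c\<ge>0. \<forall>x\<in>S. p (\<lambda>k. c *\<^sub>R x k) = c * p x)"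

definition linear_on_funs :: "('k \<Rightarrow> 'a::real_vector) set \<Rightarrow> (('k \<Rightarrow> 'a) \<Rightarrow> real) \<Rightarrow> bool" where
  "linear_on_funs S F \<longleftrightarrow>
     (\<forall>x\<in>S. \<forall>y\<in>S. F (\<lambda>k. x k + y k) = F x + F y) \<and>
     (\<forall>c. \<forall>x\<in>S. F (\<lambda>k. c *\<^sub>R x k) = c * F x)"

text \<open>A pair (y, r) stands for the constraint r <= F y on a linear functional F to be found.
  Sums and nonnegative multiples of constraints are again consequences of them, so a cone is the
  natural closure.\<close>

definition fun_cone :: "('k \<Rightarrow> 'a::real_vector) set \<Rightarrow> (('k \<Rightarrow> 'a) \<times> real) set \<Rightarrow> bool" where
  "fun_cone S C \<longleftrightarrow> C \<subseteq> S \<times> UNIV \<and> ((\<lambda>_. 0), 0) \<in> C \<and>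
     (\<forall>(x, r)\<in>C. \<forall>(y, s)\<in>C. ((\<lambda>k. x k + y k), r + s) \<in> C) \<and>
     (\<forall>c\<ge>0. \<forall>(x, r)\<in>C. ((\<lambda>k. c *\<^sub>R x k), c * r) \<in> C)"

lemma fun_subspace_zero: "fun_subspace S \<Longrightarrow> (\<lambda>_. 0) \<in> S"
  and fun_subspace_add: "fun_subspace S \<Longrightarrow> x \<in> S \<Longrightarrow> y \<in> S \<Longrightarrow> (\<lambda>k. x k + y k) \<in> S"
  and fun_subspace_scale: "fun_subspace S \<Longrightarrow> x \<in> S \<Longrightarrow> (\<lambda>k. c *\<^sub>R x k) \<in> S"
  by (auto simp: fun_subspace_def)

lemma fun_subspace_uminus: "fun_subspace S \<Longrightarrow> x \<in> S \<Longrightarrow> (\<lambda>k. - x k) \<in> S"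
  using fun_subspace_scale[of S x "-1"] by simp

lemma sublinear_on_add: "sublinear_on S p \<Longrightarrow> x \<in> S \<Longrightarrow> y \<in> S \<Longrightarrow> p (\<lambda>k. x k + y k) \<le> p x + p y"
  and sublinear_on_scale: "sublinear_on S p \<Longrightarrow> x \<in> S \<Longrightarrow> c \<ge> 0 \<Longrightarrow> p (\<lambda>k. c *\<^sub>R x k) = c * p x"
  by (auto simp: sublinear_on_def)

lemma linear_on_funs_add:
    "linear_on_funs S F \<Longrightarrow> x \<in> S \<Longrightarrow> y \<in> S \<Longrightarrow> F (\<lambda>k. x k + y k) = F x + F y"
  and linear_on_funs_scale: "linear_on_funs S F \<Longrightarrow> x \<in> S \<Longrightarrow> F (\<lambda>k. c *\<^sub>R x k) = c * F x"
  by (auto simp: linear_on_funs_def)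

lemma sublinear_on_zero:
  assumes "fun_subspace S" "sublinear_on S p"
  shows "p (\<lambda>_. 0) = 0"
  using sublinear_on_scale[OF assms(2) fun_subspace_zero[OF assms(1)], of 0] by simp

lemma sublinear_on_uminus:
  assumes "fun_subspace S" "sublinear_on S p" "x \<in> S" "y \<in> S"
  shows "p y \<le> p (\<lambda>k. x k + y k) + p (\<lambda>k. - x k)"
  using sublinear_on_add[OF assms(2) fun_subspace_add[OF assms(1,3,4)]
      fun_subspace_uminus[OF assms(1,3)]] by simp

text \<open>The constraints in \<open>C\<close> are absorbed into a smaller sublinear bound: the
  pair (0, 0) gives q <= p, while q (- y) <= - r, tested against a linear F <= q, reads r <= F y.
  Compatibility of the constraints with p keeps the infimum finite.\<close>

lemma sublinear_on_cone_inf: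
  assumes S: "fun_subspace S" and p: "sublinear_on S p" and C: "fun_cone S C"
    and le: "\<And>y r. (y, r) \<in> C \<Longrightarrow> r \<le> p y"
  defines "q \<equiv> (\<lambda>x\<in>S. INF (y, r)\<in>C. p (\<lambda>k. x k + y k) - r)"
  shows "sublinear_on S q" "\<And>x. x \<in> S \<Longrightarrow> q x \<le> p x"
    "\<And>y r. (y, r) \<in> C \<Longrightarrow> q (\<lambda>k. - y k) \<le> - r"
proof -
  have zero: "((\<lambda>_. 0), 0) \<in> C" and CS: "\<And>y r. (y, r) \<in> C \<Longrightarrow> y \<in> S"
    using C by (auto simp: fun_cone_def)
  have neg: "(\<lambda>k. - x k) \<in> S" if "x \<in> S" for x
    using fun_subspace_uminus[OF S that] .
  have low: "- p (\<lambda>k. - x k) \<le> p (\<lambda>k. x k + y k) - r" if "x \<in> S" "(y, r) \<in> C" for x y r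
    using sublinear_on_uminus[OF S p that(1) CS[OF that(2)]] le[OF that(2)] by simp
  have bdd: "bdd_below ((\<lambda>(y, r). p (\<lambda>k. x k + y k) - r) ` C)" if "x \<in> S" for x
    using low[OF that] by (intro bdd_belowI[of _ "- p (\<lambda>k. - x k)"]) auto
  have lower: "q x \<le> p (\<lambda>k. x k + y k) - r" if "x \<in> S" "(y, r) \<in> C" for x y r
    using cINF_lower[OF bdd[OF that(1)] that(2)] that(1) by (simp add: q_def)
  have greatest: "b \<le> q x" if "x \<in> S" "\<And>y r. (y, r) \<in> C \<Longrightarrow> b \<le> p (\<lambda>k. x k + y k) - r" for x b
    using that zero by (auto simp: q_def intro!: cINF_greatest)
  show qp: "q x \<le> p x" if "x \<in> S" for x
    using lower[OF that zero] by simp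
  show "q (\<lambda>k. - y k) \<le> - r" if "(y, r) \<in> C" for y r
    using lower[OF neg[OF CS[OF that]] that] sublinear_on_zero[OF S p] by simp
  have add: "q (\<lambda>k. x k + y k) \<le> q x + q y" if xy: "x \<in> S" "y \<in> S" for x y
  proof -
    have *: "q (\<lambda>k. x k + y k) \<le> (p (\<lambda>k. x k + u k) - r) + (p (\<lambda>k. y k + v k) - s)"
      if uv: "(u, r) \<in> C" "(v, s) \<in> C" for u r v s
    proof -
      have "((\<lambda>k. u k + v k), r + s) \<in> C" using C uv by (auto simp: fun_cone_def)
      then have "q (\<lambda>k. x k + y k) \<le> p (\<lambda>k. (x k + y k) + (u k + v k)) - (r + s)"
        using S xy by (intro lower) (auto simp: fun_subspace_def)
      also have "(\<lambda>k. (x k + y k) + (u k + v k)) = (\<lambda>k. (x k + u k) + (y k + v k))"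
        by (simp add: algebra_simps)
      also have "p (\<lambda>k. (x k + u k) + (y k + v k)) \<le> p (\<lambda>k. x k + u k) + p (\<lambda>k. y k + v k)"
        using p S xy CS[OF uv(1)] CS[OF uv(2)] by (simp add: sublinear_on_def fun_subspace_def)
      finally show ?thesis by simp
    qed
    \<comment> \<open>The two infima on the right-hand side are taken one after the other.\<close>
    have "q (\<lambda>k. x k + y k) - (p (\<lambda>k. x k + u k) - r) \<le> q y" if "(u, r) \<in> C" for u r
      by (rule greatest[OF xy(2)]) (use *[OF that] in \<open>simp add: algebra_simps\<close>)
    then have "q (\<lambda>k. x k + y k) - q y \<le> q x"
      by (intro greatest[OF xy(1)]) (simp add: algebra_simps)
    then show ?thesis by simp
  qed
  have scale_le: "q (\<lambda>k. c *\<^sub>R x k) \<le> c * q x" if x: "x \<in> S" and c: "c > 0" for c x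
  proof -
    have "q (\<lambda>k. c *\<^sub>R x k) / c \<le> p (\<lambda>k. x k + y k) - r" if y: "(y, r) \<in> C" for y r
    proof -
      have "((\<lambda>k. c *\<^sub>R y k), c * r) \<in> C"
        using C y c unfolding fun_cone_def by (auto dest!: spec[of _ c])
      then have "q (\<lambda>k. c *\<^sub>R x k) \<le> p (\<lambda>k. c *\<^sub>R x k + c *\<^sub>R y k) - c * r"
        using S x by (intro lower) (auto simp: fun_subspace_def)
      also have "p (\<lambda>k. c *\<^sub>R x k + c *\<^sub>R y k) = p (\<lambda>k. c *\<^sub>R (x k + y k))"
        by (simp add: algebra_simps)
      also have "\<dots> = c * p (\<lambda>k. x k + y k)"
        using p S x c CS[OF y] by (simp add: sublinear_on_def fun_subspace_def)
      finally show ?thesis using c by (simp add: field_simps)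
    qed
    then have "q (\<lambda>k. c *\<^sub>R x k) / c \<le> q x" by (intro greatest[OF x])
    then show ?thesis using c by (simp add: field_simps)
  qed
  have scale: "q (\<lambda>k. c *\<^sub>R x k) = c * q x" if x: "x \<in> S" and c: "c > 0" for c x
  proof (rule antisym[OF scale_le[OF x c]])
    have "(\<lambda>k. c *\<^sub>R x k) \<in> S" using S x by (simp add: fun_subspace_def)
    from scale_le[OF this, of "1 / c"] c show "c * q x \<le> q (\<lambda>k. c *\<^sub>R x k)"
      by (simp add: field_simps)
  qed
  have S0: "(\<lambda>_. 0) \<in> S" using S by (simp add: fun_subspace_def)
  have q0: "q (\<lambda>_. 0) = 0"
    using scale[OF S0, of 2] by simp
  have "q (\<lambda>k. c *\<^sub>R x k) = c * q x" if "x \<in> S" "c \<ge> 0" for c x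
    using scale[OF that(1), of c] q0 that(2) by (cases "c = 0") auto
  then show "sublinear_on S q" using add by (auto simp: sublinear_on_def)
qed

text \<open>If \<open>p (- a) \<noteq> - p a\<close>, the cone spanned by the single pair \<open>(a, p a)\<close> yields a strictly
  smaller sublinear functional.\<close>

lemma minimal_sublinear_imp_linear:
  assumes S: "fun_subspace S" and p: "sublinear_on S p"
    and min: "\<And>q. sublinear_on S q \<Longrightarrow> \<forall>x\<in>S. q x \<le> p x \<Longrightarrow> \<forall>x\<in>S. q x = p x"
  shows "linear_on_funs S p"
proof -
  have neg: "p (\<lambda>k. - a k) = - p a" if a: "a \<in> S" for a
  proof -
    define C where "C = (\<lambda>t. ((\<lambda>k. t *\<^sub>R a k), t * p a)) ` {0..}"
    have cone: "fun_cone S C"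
      unfolding fun_cone_def
    proof (intro conjI)
      show "C \<subseteq> S \<times> UNIV" using S a by (auto simp: C_def fun_subspace_def)
      show "((\<lambda>_. 0), 0) \<in> C" by (auto simp: C_def intro!: image_eqI[of _ _ 0])
      show "\<forall>(x, r)\<in>C. \<forall>(y, s)\<in>C. ((\<lambda>k. x k + y k), r + s) \<in> C"
      proof (clarsimp simp: C_def)
        fix s t :: real assume "0 \<le> s" "0 \<le> t"
        then show "((\<lambda>k. s *\<^sub>R a k + t *\<^sub>R a k), s * p a + t * p a)
            \<in> (\<lambda>t. ((\<lambda>k. t *\<^sub>R a k), t * p a)) ` {0..}"
          by (intro image_eqI[of _ _ "s + t"]) (auto simp: algebra_simps)
      qed
      show "\<forall>c\<ge>0. \<forall>(x, r)\<in>C. ((\<lambda>k. c *\<^sub>R x k), c * r) \<in> C"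
      proof (clarsimp simp: C_def)
        fix c t :: real assume "0 \<le> c" "0 \<le> t"
        then show "((\<lambda>k. (c * t) *\<^sub>R a k), c * (t * p a))
            \<in> (\<lambda>t. ((\<lambda>k. t *\<^sub>R a k), t * p a)) ` {0..}"
          by (intro image_eqI[of _ _ "c * t"]) auto
      qed
    qed
    have le: "r \<le> p y" if "(y, r) \<in> C" for y r
      using that p a by (auto simp: C_def sublinear_on_def)
    obtain q where q: "sublinear_on S q" "\<And>x. x \<in> S \<Longrightarrow> q x \<le> p x"
      "\<And>y r. (y, r) \<in> C \<Longrightarrow> q (\<lambda>k. - y k) \<le> - r"
      by (rule that[OF sublinear_on_cone_inf[OF S p cone le]])
    have "(a, p a) \<in> C" by (auto simp: C_def intro!: image_eqI[of _ _ 1])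
    \<comment> \<open>Minimality identifies q with p on \<open>S\<close>, so this becomes one half
      of oddness; subadditivity at a + (- a) = 0 gives the other half.\<close>
    then have "q (\<lambda>k. - a k) \<le> - p a" by (rule q(3))
    moreover have mem: "(\<lambda>k. - a k) \<in> S"
      using fun_subspace_uminus[OF S a] .
    moreover have "\<forall>x\<in>S. q x = p x" using q by (intro min) auto
    ultimately have "p (\<lambda>k. - a k) \<le> - p a" by simp
    moreover have "p (\<lambda>k. a k + - a k) \<le> p a + p (\<lambda>k. - a k)"
      by (rule sublinear_on_add[OF p a mem])
    then have "0 \<le> p a + p (\<lambda>k. - a k)" using sublinear_on_zero[OF S p] by simp
    ultimately show ?thesis by simp
  qed
  have "p (\<lambda>k. x k + y k) = p x + p y" if xy: "x \<in> S" "y \<in> S" for x y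
  proof (rule antisym)
    show "p (\<lambda>k. x k + y k) \<le> p x + p y" using p xy by (simp add: sublinear_on_def)
    show "p x + p y \<le> p (\<lambda>k. x k + y k)"
      using sublinear_on_uminus[OF S p xy] neg[OF xy(1)] by simp
  qed
  moreover have "p (\<lambda>k. c *\<^sub>R x k) = c * p x" if x: "x \<in> S" for c x
  proof (cases "c \<ge> 0")
    case True
    then show ?thesis using p x by (simp add: sublinear_on_def)
  next
    case False
    then have "p (\<lambda>k. (-c) *\<^sub>R x k) = (-c) * p x"
      by (intro sublinear_on_scale[OF p x]) simp
    then show ?thesis using neg[OF fun_subspace_scale[OF S x, of c]] by simp
  qed
  ultimately show ?thesis by (simp add: linear_on_funs_def)
qed

text \<open>A pointwise minimal element among the sublinear functionals below p is linear, and
  Zorn's lemma provides one.\<close>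

lemma ex_linear_le_sublinear:
  fixes S :: "('k \<Rightarrow> 'a::real_vector) set"
  assumes S: "fun_subspace S" and p: "sublinear_on S p"
  shows "\<exists>F. linear_on_funs S F \<and> (\<forall>x\<in>S. F x \<le> p x)"
proof -
  \<comment> \<open>Extensionality fixes the values off \<open>S\<close>, which makes the pointwise
    order on \<open>S\<close> antisymmetric.\<close>
  define A where "A = {q \<in> extensional S. sublinear_on S q \<and> (\<forall>x\<in>S. q x \<le> p x)}"
  define R where "R = (\<lambda>a b. \<forall>x\<in>S. b x \<le> (a x :: real))"
  have restrict: "sublinear_on S (restrict q S) \<longleftrightarrow> sublinear_on S q" for q
    using S by (auto simp: sublinear_on_def fun_subspace_def)
  have po: "partial_order_on A (relation_of R A)"
    unfolding partial_order_on_def preorder_on_def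
  proof (intro conjI)
    show "antisym (relation_of R A)"
      unfolding antisym_def relation_of_def R_def A_def
      by (auto intro!: extensionalityI[of _ S] intro: order.antisym)
  qed (fastforce simp: refl_on_def trans_def relation_of_def R_def)+
  have "\<exists>m\<in>A. \<forall>a\<in>A. R m a \<longrightarrow> a = m"
  proof (rule predicate_Zorn[OF po])
    fix C assume C: "C \<in> Chains (relation_of R A)"
    have tot: "R a b \<or> R b a" and CA: "a \<in> A" if "a \<in> C" "b \<in> C" for a b
      using that C by (auto simp: Chains_def relation_of_def)
    show "\<exists>u\<in>A. \<forall>a\<in>C. R a u"
    proof (cases "C = {}")
      case True
      then show ?thesis using p restrict
        by (intro bexI[of _ "restrict p S"]) (auto simp: A_def)
    next
      case False
      define u where "u = (\<lambda>x. INF q\<in>C. q x)"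
      have sub: "sublinear_on S q" "\<And>x. x \<in> S \<Longrightarrow> q x \<le> p x" if "q \<in> C" for q
        using CA[OF that that] by (auto simp: A_def)
      have neg: "(\<lambda>k. - x k) \<in> S" if "x \<in> S" for x
        using fun_subspace_uminus[OF S that] .
      \<comment> \<open>This bound is the same for all members of the chain, so their pointwise
        infimum is finite.\<close>
      have "- p (\<lambda>k. - x k) \<le> q x" if "x \<in> S" "q \<in> C" for q x
        using sublinear_on_uminus[OF S sub(1)[OF that(2)] that(1), of "\<lambda>_. 0"] S
          sub(2)[OF that(2) neg[OF that(1)]] sublinear_on_zero[OF S sub(1)[OF that(2)]]
        by (auto simp: fun_subspace_def)
      then have "bdd_below ((\<lambda>q. q x) ` C)" if "x \<in> S" for x
        using that by (intro bdd_belowI[of _ "- p (\<lambda>k. - x k)"]) auto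
      then have lower: "u x \<le> q x" if "x \<in> S" "q \<in> C" for x q
        using that by (auto simp: u_def intro: cINF_lower)
      have greatest: "b \<le> u x" if "\<And>q. q \<in> C \<Longrightarrow> b \<le> q x" for b x
        using that False by (auto simp: u_def intro: cINF_greatest)
      have "u (\<lambda>k. x k + y k) \<le> u x + u y" if xy: "x \<in> S" "y \<in> S" for x y
      proof -
        have xyS: "(\<lambda>k. x k + y k) \<in> S" using S xy by (simp add: fun_subspace_def)
        \<comment> \<open>The smaller of the two comparable functionals bounds \<open>u\<close> at x
          + y; enlarging one of its two values gives the mixed sum.\<close>
        have *: "u (\<lambda>k. x k + y k) \<le> q x + r y" if qr: "q \<in> C" "r \<in> C" for q r
          using tot[OF qr]
        proof
          assume "R q r"
          then have "r x \<le> q x" using xy by (simp add: R_def)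
          moreover have "r (\<lambda>k. x k + y k) \<le> r x + r y"
            using sub(1)[OF qr(2)] xy by (simp add: sublinear_on_def)
          ultimately show ?thesis using lower[OF xyS qr(2)] by simp
        next
          assume "R r q"
          then have "q y \<le> r y" using xy by (simp add: R_def)
          moreover have "q (\<lambda>k. x k + y k) \<le> q x + q y"
            using sub(1)[OF qr(1)] xy by (simp add: sublinear_on_def)
          ultimately show ?thesis using lower[OF xyS qr(1)] by simp
        qed
        have "u (\<lambda>k. x k + y k) - q x \<le> u y" if "q \<in> C" for q
          by (rule greatest) (use *[OF that] in \<open>simp add: algebra_simps\<close>)
        then have "u (\<lambda>k. x k + y k) - u y \<le> u x"
          by (intro greatest) (simp add: algebra_simps)
        then show ?thesis by simp
      qed
      moreover have "u (\<lambda>k. c *\<^sub>R x k) = c * u x" if x: "x \<in> S" and c: "c \<ge> 0" for c x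
      proof -
        have eq: "q (\<lambda>k. c *\<^sub>R x k) = c * q x" if "q \<in> C" for q
          using sub(1)[OF that] x c by (simp add: sublinear_on_def)
        have cx: "(\<lambda>k. c *\<^sub>R x k) \<in> S" using S x by (simp add: fun_subspace_def)
        show ?thesis
        proof (cases "c = 0")
          case True
          have "u (\<lambda>k. c *\<^sub>R x k) = (INF q\<in>C. 0)"
            unfolding u_def by (rule INF_cong) (use eq True in simp_all)
          then show ?thesis using True \<open>C \<noteq> {}\<close> by simp
        next
          case c0: False
          with c have c0: "c > 0" by simp
          have "u (\<lambda>k. c *\<^sub>R x k) / c \<le> u x"
            by (rule greatest) (use lower[OF cx] eq c0 in \<open>simp add: field_simps\<close>)
          moreover have "c * u x \<le> u (\<lambda>k. c *\<^sub>R x k)"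
            by (rule greatest) (simp add: eq lower[OF x] c0 mult_le_cancel_left_pos)
          ultimately show ?thesis using c0 by (simp add: field_simps)
        qed
      qed
      ultimately have "sublinear_on S u" by (simp add: sublinear_on_def)
      moreover obtain q where "q \<in> C" using False by auto
      then have "u x \<le> p x" if "x \<in> S" for x
        using lower[OF that] sub(2)[OF _ that] by force
      ultimately have "restrict u S \<in> A" using restrict by (simp add: A_def)
      moreover have "\<forall>a\<in>C. R a (restrict u S)" using lower by (simp add: R_def)
      ultimately show ?thesis by blast
    qed
  qed
  then obtain m where m: "m \<in> A" "\<And>a. a \<in> A \<Longrightarrow> R m a \<Longrightarrow> a = m" by blast
  have "\<forall>x\<in>S. q x = m x" if "sublinear_on S q" "\<forall>x\<in>S. q x \<le> m x" for q
  proof -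
    have "restrict q S \<in> A"
      using that m(1) restrict by (auto simp: A_def intro: order_trans)
    then have "restrict q S = m" by (rule m(2)) (use that in \<open>simp add: R_def\<close>)
    then show ?thesis by auto
  qed
  then have "linear_on_funs S m"
    using m(1) by (intro minimal_sublinear_imp_linear[OF S]) (auto simp: A_def)
  then show ?thesis using m(1) by (auto simp: A_def)
qed

text \<open>A linear F below the infimum functional of \<open>sublinear_on_cone_inf\<close> is
  dominated by p and satisfies all constraints of \<open>C\<close> at once. This is separation in
  the form in which it is used: the constraints will keep a whole family of tuples at a distance
  from a given one.\<close>

theorem hahn_banach_cone:
  assumes S: "fun_subspace S" and p: "sublinear_on S p" and C: "fun_cone S C"
    and le: "\<And>y r. (y, r) \<in> C \<Longrightarrow> r \<le> p y"
  shows "\<exists>F. linear_on_funs S F \<and> (\<forall>x\<in>S. F x \<le> p x) \<and> (\<forall>(y, r)\<in>C. r \<le> F y)"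
proof -
  obtain q where q: "sublinear_on S q" "\<And>x. x \<in> S \<Longrightarrow> q x \<le> p x"
    "\<And>y r. (y, r) \<in> C \<Longrightarrow> q (\<lambda>k. - y k) \<le> - r"
    by (rule that[OF sublinear_on_cone_inf[OF S p C le]])
  obtain F where F: "linear_on_funs S F" "\<forall>x\<in>S. F x \<le> q x"
    using ex_linear_le_sublinear[OF S q(1)] by auto
  have "r \<le> F y" if "(y, r) \<in> C" for y r
  proof -
    have y: "y \<in> S" using C that by (auto simp: fun_cone_def)
    have "F (\<lambda>k. - y k) = - F y" using linear_on_funs_scale[OF F(1) y, of "-1"] by simp
    then show ?thesis using F(2) fun_subspace_uminus[OF S y] q(3)[OF that] by fastforce
  qed
  then show ?thesis using F q(2) by (blast intro: order_trans)
qed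


section \<open>The spaces \<open>linf\<close> and ultrapowers\<close>

lemma linf_simps:
  "carrier (linf I) = {f \<in> extensional I. bounded (f ` I)}"
  "f \<oplus>\<^bsub>linf I\<^esub> g = (\<lambda>i\<in>I. f i + g i)"
  "\<zero>\<^bsub>linf I\<^esub> = (\<lambda>i\<in>I. 0)"
  "c \<odot>\<^bsub>linf I\<^esub> f = (\<lambda>i\<in>I. c *\<^sub>R f i)"
  "vnorm (linf I) f = (SUP i\<in>I. norm (f i))"
  by (simp_all add: linf_def)

lemma bounded_image_add:
  fixes f g :: "'i \<Rightarrow> 'a::real_normed_vector"
  assumes "bounded (f ` I)" "bounded (g ` I)"
  shows "bounded ((\<lambda>i. f i + g i) ` I)"
  using bounded_plus_comp[OF assms] .

lemma bounded_image_scale: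
  fixes f :: "'i \<Rightarrow> 'a::real_normed_vector"
  assumes "bounded (f ` I)"
  shows "bounded ((\<lambda>i. c *\<^sub>R f i) ` I)"
  using bounded_scaleR_comp[OF assms] .

lemma bounded_image_sum:
  fixes g :: "'b \<Rightarrow> 'i \<Rightarrow> 'a::real_normed_vector"
  assumes "\<And>a. a \<in> A \<Longrightarrow> bounded (g a ` I)"
  shows "bounded ((\<lambda>i. \<Sum>a\<in>A. g a i) ` I)"
  using assms
  by (induction A rule: infinite_finite_induct)
     (auto intro!: bounded_image_add intro: bounded_subset[of "{0}"])

lemma abelian_group_linf:
  fixes I :: "'i set"
  shows "abelian_group (linf I :: ('i \<Rightarrow> 'a::real_normed_vector) nspace)"
proof (rule abelian_groupI)
  fix f :: "'i \<Rightarrow> 'a" assume f: "f \<in> carrier (linf I)"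
  show "\<exists>g\<in>carrier (linf I). g \<oplus>\<^bsub>linf I\<^esub> f = \<zero>\<^bsub>linf I\<^esub>"
    using f bounded_image_scale[of f I "-1"]
    by (intro bexI[of _ "\<lambda>i\<in>I. - f i"]) (auto simp: linf_simps cong: image_cong)
  show "\<zero>\<^bsub>linf I\<^esub> \<oplus>\<^bsub>linf I\<^esub> f = f"
    using f by (auto simp: linf_simps extensional_def)
next
  have "bounded ((\<lambda>_. 0 :: 'a) ` I)" by (auto simp: bounded_iff)
  then show "\<zero>\<^bsub>linf I\<^esub> \<in> carrier (linf I :: ('i \<Rightarrow> 'a) nspace)"
    by (simp add: linf_simps cong: image_cong)
qed (auto simp: linf_simps bounded_image_add algebra_simps
      cong: image_cong restrict_cong)

lemma linf_minus:
  assumes "f \<in> carrier (linf I)" "g \<in> carrier (linf I)"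
  shows "f \<ominus>\<^bsub>linf I\<^esub> g = (\<lambda>i\<in>I. f i - g i)"
proof -
  have "(\<lambda>i\<in>I. - g i) \<in> carrier (linf I)"
    using assms(2) bounded_image_scale[of g I "-1"] by (auto simp: linf_simps cong: image_cong)
  then have "\<ominus>\<^bsub>linf I\<^esub> g = (\<lambda>i\<in>I. - g i)"
    using assms(2) by (intro abelian_group.minus_equality[OF abelian_group_linf])
      (auto simp: linf_simps)
  then show ?thesis by (auto simp: a_minus_def linf_simps)
qed

lemma linf_finsum:
  assumes "finite A" "\<And>a. a \<in> A \<Longrightarrow> g a \<in> carrier (linf I)"
  shows "(\<Oplus>\<^bsub>linf I\<^esub>a\<in>A. g a) = (\<lambda>i\<in>I. \<Sum>a\<in>A. g a i)"
proof -
  interpret abelian_group "linf I" by (rule abelian_group_linf)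
  show ?thesis using assms
    by (induction A) (auto simp: finsum_insert linf_simps Pi_def)
qed

context ultrafilter_on
begin

subsection \<open>The limit of the norms\<close>

text \<open>The seminorm on bounded functions that becomes the quotient norm on classes. Its
  arguments are total functions, whose values off \<open>\<Lambda>\<close> do not influence the
  limit, so that plain lambda terms can stand for elements of
  \<open>carrier (linf \<Lambda>)\<close>.\<close>

definition ultranorm :: "('i \<Rightarrow> 'a::real_normed_vector) \<Rightarrow> real" where
  "ultranorm f = Lim U (\<lambda>i. norm (f i))"

lemma tendsto_ultranorm:
  assumes "bounded (f ` \<Lambda>)"
  shows "((\<lambda>i. norm (f i)) \<longlongrightarrow> ultranorm f) U"
proof -
  obtain b where "\<And>i. i \<in> \<Lambda> \<Longrightarrow> norm (f i) \<le> b"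
    using assms by (auto simp: bounded_iff)
  then obtain l where "((\<lambda>i. norm (f i)) \<longlongrightarrow> l) U"
    using compact_limit[of "{0..b}" "\<lambda>i. norm (f i)"] by auto
  then show ?thesis unfolding ultranorm_def by (simp add: tendsto_Lim)
qed

lemma ultranorm_eqI: "((\<lambda>i. norm (f i)) \<longlongrightarrow> l) U \<Longrightarrow> ultranorm f = l"
  unfolding ultranorm_def by (simp add: tendsto_Lim)

lemma ultranorm_cong: "(\<And>i. i \<in> \<Lambda> \<Longrightarrow> f i = g i) \<Longrightarrow> ultranorm f = ultranorm g"
proof -
  assume "\<And>i. i \<in> \<Lambda> \<Longrightarrow> f i = g i"
  then have "((\<lambda>i. norm (f i)) \<longlongrightarrow> l) U \<longleftrightarrow> ((\<lambda>i. norm (g i)) \<longlongrightarrow> l) U" for l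
    by (intro tendsto_cong eventually_on_base) simp
  then show ?thesis by (simp add: ultranorm_def Topological_Spaces.Lim_def)
qed

lemma ultranorm_restrict [simp]: "ultranorm (restrict f \<Lambda>) = ultranorm f"
  by (rule ultranorm_cong) simp

lemma bounded_imageI: "(\<And>i. norm (f i) \<le> c) \<Longrightarrow> bounded (f ` \<Lambda>)"
  by (auto simp: bounded_iff)

lemma ultranorm_nonneg: "bounded (f ` \<Lambda>) \<Longrightarrow> 0 \<le> ultranorm f"
  by (rule tendsto_lowerbound[OF tendsto_ultranorm]) auto

lemma ultranorm_le: "bounded (f ` \<Lambda>) \<Longrightarrow> \<forall>\<^sub>F i in U. norm (f i) \<le> c \<Longrightarrow> ultranorm f \<le> c"
  by (rule tendsto_upperbound[OF tendsto_ultranorm]) auto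

lemma ultranorm_ge: "bounded (f ` \<Lambda>) \<Longrightarrow> \<forall>\<^sub>F i in U. c \<le> norm (f i) \<Longrightarrow> c \<le> ultranorm f"
  by (rule tendsto_lowerbound[OF tendsto_ultranorm]) auto

lemma ultranorm_less: "bounded (f ` \<Lambda>) \<Longrightarrow> ultranorm f < c \<Longrightarrow> \<forall>\<^sub>F i in U. norm (f i) < c"
  by (rule order_tendstoD(2)[OF tendsto_ultranorm])

lemma less_ultranorm: "bounded (f ` \<Lambda>) \<Longrightarrow> c < ultranorm f \<Longrightarrow> \<forall>\<^sub>F i in U. c < norm (f i)"
  by (rule order_tendstoD(1)[OF tendsto_ultranorm])

lemma ultranorm_add:
  assumes "bounded (f ` \<Lambda>)" "bounded (g ` \<Lambda>)"
  shows "ultranorm (\<lambda>i. f i + g i) \<le> ultranorm f + ultranorm g"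
  by (rule tendsto_le[OF nontrivial
        tendsto_add[OF tendsto_ultranorm[OF assms(1)] tendsto_ultranorm[OF assms(2)]]
        tendsto_ultranorm[OF bounded_image_add[OF assms]]])
     (simp add: norm_triangle_ineq)

lemma ultranorm_scale:
  assumes "bounded (f ` \<Lambda>)"
  shows "ultranorm (\<lambda>i. c *\<^sub>R f i) = \<bar>c\<bar> * ultranorm f"
  using tendsto_mult_left[OF tendsto_ultranorm[OF assms], of "\<bar>c\<bar>"] by (intro ultranorm_eqI) simp

lemma ultranorm_diff_commute: "ultranorm (\<lambda>i. f i - g i) = ultranorm (\<lambda>i. g i - f i)"
  by (simp add: ultranorm_def norm_minus_commute)

lemma ultranorm_zero [simp]: "ultranorm (\<lambda>_. 0) = 0"
  by (rule ultranorm_eqI) simp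

lemma bounded_image_uminus: "bounded (g ` \<Lambda>) \<Longrightarrow> bounded ((\<lambda>i. - g i) ` \<Lambda>)"
  for g :: "'i \<Rightarrow> 'a::real_normed_vector"
  using bounded_image_scale[of g \<Lambda> "-1"] by simp

lemma bounded_image_diff: "bounded (f ` \<Lambda>) \<Longrightarrow> bounded (g ` \<Lambda>) \<Longrightarrow> bounded ((\<lambda>i. f i - g i) ` \<Lambda>)"
  for g :: "'i \<Rightarrow> 'a::real_normed_vector"
  using bounded_image_add[of f \<Lambda> "\<lambda>i. - g i"] bounded_image_uminus[of g] by simp

lemma ultranorm_uminus: "ultranorm (\<lambda>i. - f i) = ultranorm f"
  by (simp add: ultranorm_def)

lemma ultranorm_diff:
  assumes "bounded (f ` \<Lambda>)" "bounded (g ` \<Lambda>)"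
  shows "ultranorm (\<lambda>i. f i - g i) \<le> ultranorm f + ultranorm g"
  using ultranorm_add[OF assms(1) bounded_image_uminus[OF assms(2)]]
  by (simp add: ultranorm_uminus)

lemma ultranorm_triangle:
  assumes "bounded (f ` \<Lambda>)" "bounded (g ` \<Lambda>)"
  shows "ultranorm f \<le> ultranorm g + ultranorm (\<lambda>i. f i - g i)"
  using ultranorm_add[OF assms(2) bounded_image_diff[OF assms]] by simp

lemma ultranorm_sum:
  assumes "\<And>a. a \<in> A \<Longrightarrow> bounded (g a ` \<Lambda>)"
  shows "ultranorm (\<lambda>i. \<Sum>a\<in>A. g a i) \<le> (\<Sum>a\<in>A. ultranorm (g a))"
  using assms
proof (induction A rule: infinite_finite_induct)
  case (insert a A)
  have "ultranorm (\<lambda>i. \<Sum>a\<in>insert a A. g a i) = ultranorm (\<lambda>i. g a i + (\<Sum>a\<in>A. g a i))"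
    using insert by simp
  also have "\<dots> \<le> ultranorm (g a) + ultranorm (\<lambda>i. \<Sum>a\<in>A. g a i)"
    using insert by (intro ultranorm_add bounded_image_sum) auto
  finally show ?case using insert by simp
qed simp_all


subsection \<open>The quotient map\<close>

lemma c0U_eq:
  "c0U \<Lambda> U = {f :: 'i \<Rightarrow> 'a::real_normed_vector. f \<in> extensional \<Lambda> \<and> bounded (f ` \<Lambda>) \<and> ultranorm f = 0}"
proof -
  have "((\<lambda>i. norm (f i)) \<longlongrightarrow> 0) U \<longleftrightarrow> ultranorm f = 0" if "bounded (f ` \<Lambda>)" for f :: "'i \<Rightarrow> 'a"
    using tendsto_ultranorm[OF that] ultranorm_eqI[of f 0] by metis
  then show ?thesis by (auto simp: c0U_def linf_simps)
qed

lemma abelian_subgroup_c0U: "abelian_subgroup (c0U \<Lambda> U :: ('i \<Rightarrow> 'a::real_normed_vector) set) (linf \<Lambda>)"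
proof (rule abelian_subgroupI3[OF additive_subgroup.intro abelian_group_linf])
  let ?V = "linf \<Lambda> :: ('i \<Rightarrow> 'a) nspace"
  interpret abelian_group ?V by (rule abelian_group_linf)
  show "subgroup (c0U \<Lambda> U) (add_monoid ?V)"
  proof (rule add.subgroupI)
    show "c0U \<Lambda> U \<noteq> ({} :: ('i \<Rightarrow> 'a) set)"
    proof -
      have "(\<lambda>i\<in>\<Lambda>. 0 :: 'a) \<in> c0U \<Lambda> U"
        using bounded_imageI[of "\<lambda>_. 0 :: 'a" 0] by (simp add: c0U_eq cong: image_cong)
      then show ?thesis by auto
    qed
    fix f g :: "'i \<Rightarrow> 'a" assume f: "f \<in> c0U \<Lambda> U" and g: "g \<in> c0U \<Lambda> U"
    show "f \<oplus>\<^bsub>?V\<^esub> g \<in> c0U \<Lambda> U"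
      using f g ultranorm_add[of f g] ultranorm_nonneg[of "\<lambda>i. f i + g i"] bounded_image_add[of f \<Lambda> g]
      by (auto simp: c0U_eq linf_simps cong: image_cong)
    have "\<zero>\<^bsub>?V\<^esub> \<in> carrier ?V" by simp
    then have "\<ominus>\<^bsub>?V\<^esub> f = (\<lambda>i\<in>\<Lambda>. - f i)"
      using linf_minus[of "\<zero>\<^bsub>?V\<^esub>" \<Lambda> f] f
      by (simp add: c0U_def a_minus_def l_zero) (auto simp: linf_simps cong: restrict_cong)
    then show "\<ominus>\<^bsub>?V\<^esub> f \<in> c0U \<Lambda> U"
      using f bounded_image_uminus[of f] by (auto simp: c0U_eq ultranorm_uminus cong: image_cong)
  qed (auto simp: c0U_def)
qed

text \<open>Restriction turns a function bounded on \<open>\<Lambda>\<close> into an element of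
  \<open>linf \<Lambda>\<close>, so representatives need not be extensional.\<close>

definition ucls :: "('i \<Rightarrow> 'a::real_normed_vector) \<Rightarrow> ('i \<Rightarrow> 'a) set" where
  "ucls f = c0U \<Lambda> U +>\<^bsub>linf \<Lambda>\<^esub> restrict f \<Lambda>"

lemma restrict_in_linf: "bounded (f ` \<Lambda>) \<Longrightarrow> restrict f \<Lambda> \<in> carrier (linf \<Lambda>)"
  by (simp add: linf_simps cong: image_cong)

lemma ucls_eq:
  assumes "bounded (f ` \<Lambda>)"
  shows "ucls f = {g \<in> extensional \<Lambda>. bounded (g ` \<Lambda>) \<and> ultranorm (\<lambda>i. g i - f i) = 0}"
proof (intro equalityI subsetI)
  fix g assume "g \<in> ucls f"
  then obtain h where h: "h \<in> c0U \<Lambda> U" "g = (\<lambda>i\<in>\<Lambda>. h i + f i)"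
    by (auto simp: ucls_def a_r_coset_def' linf_simps cong: restrict_cong)
  have "ultranorm (\<lambda>i. g i - f i) = ultranorm h"
    by (rule ultranorm_cong) (simp add: h(2))
  then show "g \<in> {g \<in> extensional \<Lambda>. bounded (g ` \<Lambda>) \<and> ultranorm (\<lambda>i. g i - f i) = 0}"
    using h assms bounded_image_add[of h \<Lambda> f] by (auto simp: c0U_eq cong: image_cong)
next
  fix g assume g: "g \<in> {g \<in> extensional \<Lambda>. bounded (g ` \<Lambda>) \<and> ultranorm (\<lambda>i. g i - f i) = 0}"
  let ?h = "\<lambda>i\<in>\<Lambda>. g i - f i"
  have "ultranorm ?h = ultranorm (\<lambda>i. g i - f i)" by (rule ultranorm_cong) simp
  then have "?h \<in> c0U \<Lambda> U"
    using g assms bounded_image_diff[of g f] by (auto simp: c0U_eq cong: image_cong)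
  moreover have "g = ?h \<oplus>\<^bsub>linf \<Lambda>\<^esub> restrict f \<Lambda>"
    using g by (auto simp: linf_simps extensional_def)
  ultimately show "g \<in> ucls f" by (auto simp: ucls_def a_r_coset_def')
qed

lemma ucls_eqI:
  assumes "bounded (f ` \<Lambda>)" "bounded (g ` \<Lambda>)" "ultranorm (\<lambda>i. f i - g i) = 0"
  shows "ucls f = ucls g"
proof -
  have "ultranorm (\<lambda>i. h i - f i) = 0 \<longleftrightarrow> ultranorm (\<lambda>i. h i - g i) = 0" if h: "bounded (h ` \<Lambda>)" for h
    using ultranorm_triangle[of "\<lambda>i. h i - g i" "\<lambda>i. h i - f i"]
      ultranorm_triangle[of "\<lambda>i. h i - f i" "\<lambda>i. h i - g i"]
      ultranorm_nonneg[of "\<lambda>i. h i - g i"] ultranorm_nonneg[of "\<lambda>i. h i - f i"]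
      bounded_image_diff[OF h assms(1)] bounded_image_diff[OF h assms(2)] assms(3)
      ultranorm_diff_commute[of g f]
    by simp
  then show ?thesis using assms by (auto simp: ucls_eq)
qed

lemma carrier_ultrapower: "carrier (ultrapower TYPE('a::real_normed_vector) \<Lambda> U) = ucls ` {f. bounded (f ` \<Lambda>)}"
proof -
  have "carrier (ultrapower TYPE('a) \<Lambda> U) = (\<lambda>f. c0U \<Lambda> U +>\<^bsub>linf \<Lambda>\<^esub> f) ` carrier (linf \<Lambda>)"
    by (auto simp: ultrapower_def nquotient_def A_RCOSETS_def' RCOSETS_def a_r_coset_def' r_coset_def)
  also have "\<dots> = ucls ` {f. bounded (f ` \<Lambda>)}"
  proof (intro equalityI image_subsetI)
    fix f :: "'i \<Rightarrow> 'a" assume "f \<in> carrier (linf \<Lambda>)"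
    then show "c0U \<Lambda> U +>\<^bsub>linf \<Lambda>\<^esub> f \<in> ucls ` {f. bounded (f ` \<Lambda>)}"
      by (intro image_eqI[of _ _ f]) (auto simp: ucls_def linf_simps extensional_restrict)
  qed (auto simp: ucls_def restrict_in_linf)
  finally show ?thesis .
qed

lemma ucls_in_carrier: "bounded (f ` \<Lambda>) \<Longrightarrow> ucls f \<in> carrier (ultrapower TYPE('a::real_normed_vector) \<Lambda> U)"
  by (simp add: carrier_ultrapower)

lemma ucls_add:
  assumes "bounded (f ` \<Lambda>)" "bounded (g ` \<Lambda>)"
  shows "ucls f \<oplus>\<^bsub>ultrapower TYPE('a::real_normed_vector) \<Lambda> U\<^esub> ucls g = ucls (\<lambda>i. f i + g i)"
proof -
  interpret abelian_subgroup "c0U \<Lambda> U" "linf \<Lambda> :: ('i \<Rightarrow> 'a) nspace" by (rule abelian_subgroup_c0U)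
  show ?thesis
    using a_rcos_sum[OF restrict_in_linf[OF assms(1)] restrict_in_linf[OF assms(2)]]
    by (simp add: ucls_def ultrapower_def nquotient_def linf_simps cong: restrict_cong)
qed

lemma ucls_zero: "\<zero>\<^bsub>ultrapower TYPE('a::real_normed_vector) \<Lambda> U\<^esub> = ucls (\<lambda>_. 0)"
  using bounded_imageI[of "\<lambda>_. 0 :: 'a" 0]
  by (simp add: ucls_eq ultrapower_def nquotient_def c0U_eq)

lemma abelian_group_ultrapower: "abelian_group (ultrapower TYPE('a::real_normed_vector) \<Lambda> U)"
proof (rule abelian_groupI)
  fix A assume "A \<in> carrier (ultrapower TYPE('a) \<Lambda> U)"
  then obtain f :: "'i \<Rightarrow> 'a" where f: "bounded (f ` \<Lambda>)" "A = ucls f"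
    by (auto simp: carrier_ultrapower)
  show "\<exists>B\<in>carrier (ultrapower TYPE('a) \<Lambda> U).
      B \<oplus>\<^bsub>ultrapower TYPE('a) \<Lambda> U\<^esub> A = \<zero>\<^bsub>ultrapower TYPE('a) \<Lambda> U\<^esub>"
    using f bounded_image_uminus[OF f(1)]
    by (intro bexI[of _ "ucls (\<lambda>i. - f i)"]) (simp_all add: ucls_add ucls_zero ucls_in_carrier)
next
  show "\<zero>\<^bsub>ultrapower TYPE('a) \<Lambda> U\<^esub> \<in> carrier (ultrapower TYPE('a) \<Lambda> U)"
    unfolding ucls_zero by (intro ucls_in_carrier bounded_imageI[of _ 0]) simp
qed (auto simp: carrier_ultrapower ucls_add ucls_zero bounded_image_add bounded_imageI[of _ 0]
      algebra_simps)

lemma ucls_smult: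
  assumes f: "bounded (f ` \<Lambda>)"
  shows "c \<odot>\<^bsub>ultrapower TYPE('a::real_normed_vector) \<Lambda> U\<^esub> ucls f = ucls (\<lambda>i. c *\<^sub>R f i)"
proof -
  let ?V = "linf \<Lambda> :: ('i \<Rightarrow> 'a) nspace"
  have eq: "c \<odot>\<^bsub>ultrapower TYPE('a) \<Lambda> U\<^esub> ucls f = {m \<oplus>\<^bsub>?V\<^esub> (c \<odot>\<^bsub>?V\<^esub> g) | m g. m \<in> c0U \<Lambda> U \<and> g \<in> ucls f}"
    by (auto simp: ultrapower_def nquotient_def set_add_def set_mult_def)
  show ?thesis unfolding eq
  proof (intro equalityI subsetI)
    fix h assume "h \<in> {m \<oplus>\<^bsub>?V\<^esub> (c \<odot>\<^bsub>?V\<^esub> g) | m g. m \<in> c0U \<Lambda> U \<and> g \<in> ucls f}"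
    then obtain m g where m: "m \<in> c0U \<Lambda> U" and g: "g \<in> ucls f"
      and h: "h = (\<lambda>i\<in>\<Lambda>. m i + c *\<^sub>R g i)" by (auto simp: linf_simps cong: restrict_cong)
    have b: "bounded (m ` \<Lambda>)" "bounded (g ` \<Lambda>)" using m g f by (auto simp: c0U_eq ucls_eq)
    have "ultranorm (\<lambda>i. h i - c *\<^sub>R f i) = ultranorm (\<lambda>i. m i + c *\<^sub>R (g i - f i))"
      by (rule ultranorm_cong) (simp add: h algebra_simps)
    also have "\<dots> \<le> ultranorm m + \<bar>c\<bar> * ultranorm (\<lambda>i. g i - f i)"
      using ultranorm_add[OF b(1) bounded_image_scale[OF bounded_image_diff[OF b(2) f]]]
        ultranorm_scale[OF bounded_image_diff[OF b(2) f]] by simp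
    also have "\<dots> = 0" using m g f by (simp add: c0U_eq ucls_eq)
    finally have le: "ultranorm (\<lambda>i. h i - c *\<^sub>R f i) \<le> 0" .
    have bh: "bounded (h ` \<Lambda>)"
      using bounded_image_add[OF b(1) bounded_image_scale[OF b(2)]] by (simp add: h cong: image_cong)
    show "h \<in> ucls (\<lambda>i. c *\<^sub>R f i)"
      using le bh ultranorm_nonneg[OF bounded_image_diff[OF bh bounded_image_scale[OF f, of c]]]
      by (simp add: ucls_eq[OF bounded_image_scale[OF f]] h)
  next
    fix h assume h: "h \<in> ucls (\<lambda>i. c *\<^sub>R f i)"
    then obtain m where m: "m \<in> c0U \<Lambda> U" and hm: "h = (\<lambda>i\<in>\<Lambda>. m i + c *\<^sub>R f i)"
      by (auto simp: ucls_def a_r_coset_def' linf_simps cong: restrict_cong)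
    have "ultranorm (\<lambda>i. restrict f \<Lambda> i - f i) = ultranorm (\<lambda>_. 0 :: 'a)"
      by (rule ultranorm_cong) simp
    then have "restrict f \<Lambda> \<in> ucls f" using f by (simp add: ucls_eq cong: image_cong)
    moreover have "h = m \<oplus>\<^bsub>?V\<^esub> (c \<odot>\<^bsub>?V\<^esub> restrict f \<Lambda>)"
      by (simp add: hm linf_simps cong: restrict_cong)
    ultimately show "h \<in> {m \<oplus>\<^bsub>?V\<^esub> (c \<odot>\<^bsub>?V\<^esub> g) | m g. m \<in> c0U \<Lambda> U \<and> g \<in> ucls f}"
      using m by blast
  qed
qed

lemma ucls_minus:
  assumes "bounded (f ` \<Lambda>)" "bounded (g ` \<Lambda>)"
  shows "ucls f \<ominus>\<^bsub>ultrapower TYPE('a::real_normed_vector) \<Lambda> U\<^esub> ucls g = ucls (\<lambda>i. f i - g i)"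
proof -
  interpret abelian_group "ultrapower TYPE('a) \<Lambda> U" by (rule abelian_group_ultrapower)
  have "\<ominus>\<^bsub>ultrapower TYPE('a) \<Lambda> U\<^esub> ucls g = ucls (\<lambda>i. - g i)"
    using assms bounded_image_uminus
    by (intro minus_equality) (auto simp: ucls_add ucls_zero ucls_in_carrier)
  then show ?thesis
    using ucls_add[OF assms(1) bounded_image_uminus[OF assms(2)]] by (simp add: a_minus_def)
qed

lemma ucls_finsum:
  assumes "finite A" "\<And>a. a \<in> A \<Longrightarrow> bounded (g a ` \<Lambda>)"
  shows "(\<Oplus>\<^bsub>ultrapower TYPE('a::real_normed_vector) \<Lambda> U\<^esub>a\<in>A. ucls (g a)) = ucls (\<lambda>i. \<Sum>a\<in>A. g a i)"
proof -
  interpret abelian_group "ultrapower TYPE('a) \<Lambda> U" by (rule abelian_group_ultrapower)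
  show ?thesis using assms
    by (induction A) (auto simp: finsum_insert ucls_zero ucls_in_carrier ucls_add bounded_image_sum)
qed

text \<open>All representatives share the same limit of norms, which is at most the supremum of
  each. Conversely, the indices where the norm exceeds the limit by e or more are negligible, and
  setting f to zero there gives a representative with supremum at most
  \<open>ultranorm f + e\<close>.\<close>

lemma ucls_vnorm:
  assumes f: "bounded (f ` \<Lambda>)"
  shows "vnorm (ultrapower TYPE('a::real_normed_vector) \<Lambda> U) (ucls f) = ultranorm f"
proof -
  have eq: "vnorm (ultrapower TYPE('a) \<Lambda> U) (ucls f) = (INF g\<in>ucls f. SUP i\<in>\<Lambda>. norm (g i))"
    by (simp add: ultrapower_def nquotient_def linf_simps)
  have le: "ultranorm f \<le> (SUP i\<in>\<Lambda>. norm (g i))" if g: "g \<in> ucls f" for g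
  proof -
    have bg: "bounded (g ` \<Lambda>)" and 0: "ultranorm (\<lambda>i. g i - f i) = 0"
      using g f by (auto simp: ucls_eq)
    have "ultranorm f \<le> ultranorm g"
      using ultranorm_triangle[OF f bg] 0 ultranorm_diff_commute[of g f] by simp
    also have "\<dots> \<le> (SUP i\<in>\<Lambda>. norm (g i))"
    proof (rule ultranorm_le[OF bg eventually_on_base])
      show "norm (g i) \<le> (SUP i\<in>\<Lambda>. norm (g i))" if "i \<in> \<Lambda>" for i
        using bg that by (intro cSUP_upper) (simp_all add: bdd_above_norm[symmetric] image_image)
    qed
    finally show ?thesis .
  qed
  have ge: "(INF g\<in>ucls f. SUP i\<in>\<Lambda>. norm (g i)) \<le> ultranorm f + e" if e: "e > 0" for e
  proof -
    define g where "g = (\<lambda>i\<in>\<Lambda>. if norm (f i) < ultranorm f + e then f i else 0)"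
    have norm_g: "norm (g i) \<le> ultranorm f + e" if "i \<in> \<Lambda>" for i
      using that ultranorm_nonneg[OF f] e by (auto simp: g_def)
    then have bg: "bounded (g ` \<Lambda>)" by (auto simp: bounded_iff)
    have "\<forall>\<^sub>F i in U. norm (g i - f i) \<le> 0"
      using ultranorm_less[OF f, of "ultranorm f + e"] e eventually_base
      by (auto simp: g_def elim: eventually_elim2)
    then have "ultranorm (\<lambda>i. g i - f i) \<le> 0" by (rule ultranorm_le[OF bounded_image_diff[OF bg f]])
    then have "g \<in> ucls f"
      using bg ultranorm_nonneg[OF bounded_image_diff[OF bg f]] by (simp add: ucls_eq[OF f] g_def)
    then have "(INF g\<in>ucls f. SUP i\<in>\<Lambda>. norm (g i)) \<le> (SUP i\<in>\<Lambda>. norm (g i))"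
      using le by (intro cINF_lower bdd_belowI[of _ "ultranorm f"]) auto
    also have "\<dots> \<le> ultranorm f + e" using norm_g base_nonempty by (intro cSUP_least) auto
    finally show ?thesis .
  qed
  have "ucls f \<noteq> {}"
  proof -
    have "ultranorm (\<lambda>i. restrict f \<Lambda> i - f i) = ultranorm (\<lambda>_. 0 :: 'a)"
      by (rule ultranorm_cong) simp
    then have "restrict f \<Lambda> \<in> ucls f" using f by (simp add: ucls_eq cong: image_cong)
    then show ?thesis by auto
  qed
  then have "ultranorm f \<le> (INF g\<in>ucls f. SUP i\<in>\<Lambda>. norm (g i))"
    by (rule cINF_greatest) (rule le)
  with field_le_epsilon[OF ge] show ?thesis
    unfolding eq by (rule order.antisym)
qed

text \<open>Cutting off at negligible indices would not do here, since a class of norm 1 may have a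
  representative whose norms exceed 1 at all indices. The radial projection onto the ball moves f i
  by max 1 (norm (f i)) - 1, which tends to zero along the ultrafilter.\<close>

lemma vball_ultrapower:
  "vball (ultrapower TYPE('a::real_normed_vector) \<Lambda> U) = ucls ` {f. \<forall>i. norm (f i) \<le> 1}"
proof (intro equalityI subsetI)
  fix A assume A: "A \<in> vball (ultrapower TYPE('a) \<Lambda> U)"
  then obtain f :: "'i \<Rightarrow> 'a" where f: "bounded (f ` \<Lambda>)" and Af: "A = ucls f"
    by (auto simp: vball_def carrier_ultrapower)
  then have le: "ultranorm f \<le> 1" using A by (simp add: vball_def ucls_vnorm)
  define g where "g i = (1 / max 1 (norm (f i))) *\<^sub>R f i" for i
  have g: "norm (g i) \<le> 1" for i by (auto simp: g_def max_def divide_simps)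
  have norm_fg: "norm (f i - g i) = max 1 (norm (f i)) - 1" for i
  proof -
    have "f i - g i = (1 - 1 / max 1 (norm (f i))) *\<^sub>R f i" by (simp add: g_def algebra_simps)
    then have "norm (f i - g i) = (1 - 1 / max 1 (norm (f i))) * norm (f i)"
      by (simp add: abs_if)
    then show ?thesis by (cases "f i = 0") (auto simp: max_def left_diff_distrib)
  qed
  have "((\<lambda>i. norm (f i - g i)) \<longlongrightarrow> max 1 (ultranorm f) - 1) U"
    unfolding norm_fg by (intro tendsto_intros tendsto_max tendsto_ultranorm f)
  then have "ultranorm (\<lambda>i. f i - g i) = 0" using le by (intro ultranorm_eqI) (simp add: max_absorb1)
  then have "A = ucls g" unfolding Af by (intro ucls_eqI f bounded_imageI[OF g])
  then show "A \<in> ucls ` {f. \<forall>i. norm (f i) \<le> 1}" using g by auto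
next
  fix A assume "A \<in> ucls ` {f :: 'i \<Rightarrow> 'a. \<forall>i. norm (f i) \<le> 1}"
  then obtain f :: "'i \<Rightarrow> 'a" where f: "\<And>i. norm (f i) \<le> 1" "A = ucls f" by auto
  then show "A \<in> vball (ultrapower TYPE('a) \<Lambda> U)"
    using bounded_imageI[OF f(1)]
    by (auto simp: vball_def ucls_vnorm ucls_in_carrier intro!: ultranorm_le)
qed

end


section \<open>The strong diameter two property of an ultrapower\<close>

lemma sum_double: "(\<Sum>j\<in>{1..2 * n}. g j) = (\<Sum>i\<in>{1..n}. g i + g (n + i))" for n :: nat
proof -
  have "(\<Sum>j\<in>{1..2 * n}. g j) = (\<Sum>j\<in>{1..n}. g j) + (\<Sum>j\<in>{1 + n..n + n}. g j)"
    using sum.ub_add_nat[of 1 n g n] by (simp add: mult_2)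
  also have "(\<Sum>j\<in>{1 + n..n + n}. g j) = (\<Sum>i\<in>{1..n}. g (n + i))"
    by (subst sum.shift_bounds_cl_nat_ivl) (simp add: add.commute)
  finally show ?thesis by (simp add: sum.distrib)
qed

context ultrafilter_on
begin

text \<open>Functionals on the ultrapower, read on representatives. The bound by
  \<open>ultranorm\<close> makes them vanish on the kernel and ignore values off
  \<open>\<Lambda>\<close>; \<open>dual_ucls\<close> and \<open>ultrafunctional_dual\<close> are the
  two directions of the correspondence.\<close>

definition ultrafunctional :: "(('i \<Rightarrow> 'a::real_normed_vector) \<Rightarrow> real) \<Rightarrow> bool" where
  "ultrafunctional \<phi> \<longleftrightarrow>
     (\<forall>f g. bounded (f ` \<Lambda>) \<longrightarrow> bounded (g ` \<Lambda>) \<longrightarrow> \<phi> (\<lambda>i. f i + g i) = \<phi> f + \<phi> g) \<and>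
     (\<forall>c f. bounded (f ` \<Lambda>) \<longrightarrow> \<phi> (\<lambda>i. c *\<^sub>R f i) = c * \<phi> f) \<and>
     (\<exists>K. \<forall>f. bounded (f ` \<Lambda>) \<longrightarrow> \<bar>\<phi> f\<bar> \<le> K * ultranorm f)"

lemma ultrafunctional_add:
    "ultrafunctional \<phi> \<Longrightarrow> bounded (f ` \<Lambda>) \<Longrightarrow> bounded (g ` \<Lambda>) \<Longrightarrow> \<phi> (\<lambda>i. f i + g i) = \<phi> f + \<phi> g"
  and ultrafunctional_scale: "ultrafunctional \<phi> \<Longrightarrow> bounded (f ` \<Lambda>) \<Longrightarrow> \<phi> (\<lambda>i. c *\<^sub>R f i) = c * \<phi> f"
  by (auto simp: ultrafunctional_def)

lemma ultrafunctional_uminus: "ultrafunctional \<phi> \<Longrightarrow> bounded (f ` \<Lambda>) \<Longrightarrow> \<phi> (\<lambda>i. - f i) = - \<phi> f"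
  using ultrafunctional_scale[of \<phi> f "-1"] by simp

lemma ultrafunctional_diff:
  "ultrafunctional \<phi> \<Longrightarrow> bounded (f ` \<Lambda>) \<Longrightarrow> bounded (g ` \<Lambda>) \<Longrightarrow> \<phi> (\<lambda>i. f i - g i) = \<phi> f - \<phi> g"
  using ultrafunctional_add[of \<phi> f "\<lambda>i. - g i"] by (simp add: bounded_image_uminus ultrafunctional_uminus)

lemma ultrafunctional_sum:
  assumes "ultrafunctional \<phi>" "\<And>a. a \<in> A \<Longrightarrow> bounded (g a ` \<Lambda>)"
  shows "\<phi> (\<lambda>i. \<Sum>a\<in>A. g a i) = (\<Sum>a\<in>A. \<phi> (g a))"
proof -
  have "\<phi> (\<lambda>_. 0) = 0"
    using ultrafunctional_scale[OF assms(1), of "\<lambda>_. 0" 0] bounded_imageI[of "\<lambda>_. 0" 0] by simp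
  then show ?thesis using assms(2)
    by (induction A rule: infinite_finite_induct)
       (simp_all add: ultrafunctional_add[OF assms(1)] bounded_image_sum)
qed

lemma ultrafunctional_minus: "ultrafunctional \<phi> \<Longrightarrow> ultrafunctional (\<lambda>f. - \<phi> f)"
  by (auto simp: ultrafunctional_def)

lemma ultrafunctional_bound:
  assumes "ultrafunctional \<phi>"
  shows "\<exists>K\<ge>0. \<forall>f. bounded (f ` \<Lambda>) \<longrightarrow> \<bar>\<phi> f\<bar> \<le> K * ultranorm f"
proof -
  obtain K where K: "\<And>f. bounded (f ` \<Lambda>) \<Longrightarrow> \<bar>\<phi> f\<bar> \<le> K * ultranorm f"
    using assms by (auto simp: ultrafunctional_def)
  have "\<bar>\<phi> f\<bar> \<le> \<bar>K\<bar> * ultranorm f" if "bounded (f ` \<Lambda>)" for f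
    using K[OF that] mult_right_mono[OF abs_ge_self ultranorm_nonneg[OF that], of K] by simp
  then show ?thesis by (intro exI[of _ "\<bar>K\<bar>"]) auto
qed

lemma dual_ucls:
  assumes "h \<in> dual (ultrapower TYPE('a::real_normed_vector) \<Lambda> U)"
  shows "ultrafunctional (\<lambda>f :: 'i \<Rightarrow> 'a. h (ucls f))"
proof -
  obtain K where "\<And>A. A \<in> carrier (ultrapower TYPE('a) \<Lambda> U) \<Longrightarrow>
      \<bar>h A\<bar> \<le> K * vnorm (ultrapower TYPE('a) \<Lambda> U) A"
    using assms unfolding dual_def by blast
  then have "\<bar>h (ucls f)\<bar> \<le> K * ultranorm f" if "bounded (f ` \<Lambda>)" for f :: "'i \<Rightarrow> 'a"
    using that by (metis ucls_in_carrier ucls_vnorm)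
  moreover have "h (ucls (\<lambda>i. f i + g i)) = h (ucls f) + h (ucls g)"
    if "bounded (f ` \<Lambda>)" "bounded (g ` \<Lambda>)" for f g :: "'i \<Rightarrow> 'a"
    using assms that unfolding dual_def by (simp add: ucls_in_carrier flip: ucls_add)
  moreover have "h (ucls (\<lambda>i. c *\<^sub>R f i)) = c * h (ucls f)"
    if "bounded (f ` \<Lambda>)" for c and f :: "'i \<Rightarrow> 'a"
    using assms that unfolding dual_def by (simp add: ucls_in_carrier flip: ucls_smult)
  ultimately show ?thesis unfolding ultrafunctional_def by blast
qed

lemma ucls_inj_mod:
  assumes "bounded (f ` \<Lambda>)" "bounded (g ` \<Lambda>)" "ucls f = ucls g"
  shows "ultranorm (\<lambda>i. f i - g i) = 0"
proof -
  have "ucls (\<lambda>i. f i - g i) = ucls (\<lambda>i. f i - f i)"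
    using ucls_minus[OF assms(1,2)] ucls_minus[OF assms(1,1)] assms(3) by simp
  then show ?thesis
    using ucls_vnorm[OF bounded_image_diff[OF assms(1,2)]] ucls_vnorm[OF bounded_image_diff[OF assms(1,1)]]
    by simp
qed

lemma ultrafunctional_dual:
  assumes \<phi>: "ultrafunctional (\<phi> :: ('i \<Rightarrow> 'a::real_normed_vector) \<Rightarrow> real)"
  shows "\<exists>h\<in>dual (ultrapower TYPE('a) \<Lambda> U). \<forall>f. bounded (f ` \<Lambda>) \<longrightarrow> h (ucls f) = \<phi> f"
proof -
  obtain K where K: "\<And>f. bounded (f ` \<Lambda>) \<Longrightarrow> \<bar>\<phi> f\<bar> \<le> K * ultranorm f"
    using \<phi> by (auto simp: ultrafunctional_def)
  \<comment> \<open>The choice is immaterial: two representatives differ by a function of ultranorm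
    zero, on which \<phi> vanishes.\<close>
  define h where "h A = \<phi> (SOME f. bounded (f ` \<Lambda>) \<and> ucls f = A)" for A
  have h: "h (ucls f) = \<phi> f" if f: "bounded (f ` \<Lambda>)" for f
  proof -
    define g where "g = (SOME g. bounded (g ` \<Lambda>) \<and> ucls g = ucls f)"
    have g: "bounded (g ` \<Lambda>)" "ucls g = ucls f"
      using someI[of "\<lambda>g. bounded (g ` \<Lambda>) \<and> ucls g = ucls f" f] f by (auto simp: g_def)
    have "\<bar>\<phi> g - \<phi> f\<bar> \<le> 0"
      using K[OF bounded_image_diff[OF g(1) f]] ucls_inj_mod[OF g(1) f g(2)]
        ultrafunctional_diff[OF \<phi> g(1) f] by simp
    then show ?thesis by (simp add: h_def g_def)
  qed
  have "h \<in> dual (ultrapower TYPE('a) \<Lambda> U)"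
    using K unfolding dual_def
    by (auto simp: carrier_ultrapower ucls_add ucls_smult ucls_vnorm h bounded_image_add
        bounded_image_scale ultrafunctional_add[OF \<phi>] ultrafunctional_scale[OF \<phi>]
        intro!: exI[of _ K])
  then show ?thesis using h by blast
qed

definition uball :: "('i \<Rightarrow> 'a::real_normed_vector) set" where
  "uball = {f. \<forall>i. norm (f i) \<le> 1}"

lemma uball_bounded: "f \<in> uball \<Longrightarrow> bounded (f ` \<Lambda>)"
  by (rule bounded_imageI[of _ 1]) (simp add: uball_def)

lemma uball_ultranorm: "f \<in> uball \<Longrightarrow> ultranorm f \<le> 1"
  by (rule ultranorm_le[OF uball_bounded]) (simp_all add: uball_def)

lemma uball_uminus: "f \<in> uball \<Longrightarrow> (\<lambda>i. - f i) \<in> uball"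
  by (simp add: uball_def)

lemma vball_eq: "vball (ultrapower TYPE('a::real_normed_vector) \<Lambda> U) = ucls ` uball"
  by (simp add: vball_ultrapower uball_def)

lemma ultrafunctional_le_SUP:
  assumes h: "h \<in> dual (ultrapower TYPE('a::real_normed_vector) \<Lambda> U)" and f: "f \<in> uball"
  shows "h (ucls f) \<le> (SUP A\<in>vball (ultrapower TYPE('a) \<Lambda> U). h A)"
proof -
  obtain K where K: "K \<ge> 0" "\<And>f :: 'i \<Rightarrow> 'a. bounded (f ` \<Lambda>) \<Longrightarrow> \<bar>h (ucls f)\<bar> \<le> K * ultranorm f"
    using ultrafunctional_bound[OF dual_ucls[OF h]] by auto
  have "h (ucls f) \<le> K" if "f \<in> uball" for f :: "'i \<Rightarrow> 'a"
    using K(2)[OF uball_bounded[OF that]] mult_left_mono[OF uball_ultranorm[OF that] K(1)] by simp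
  \<comment> \<open>The supremum in the definition of a slice is taken in the reals, so it dominates
    the values of h only once these are known to be bounded on the ball.\<close>
  then have "bdd_above (h ` vball (ultrapower TYPE('a) \<Lambda> U))"
    unfolding vball_eq by (intro bdd_aboveI[of _ K]) auto
  then show ?thesis using f by (intro cSUP_upper) (auto simp: vball_eq)
qed

lemma less_SUP_vball:
  assumes h: "h \<in> dual (ultrapower TYPE('a::real_normed_vector) \<Lambda> U)" and e: "e > 0"
  shows "\<exists>f\<in>uball. h (ucls f) > (SUP A\<in>vball (ultrapower TYPE('a) \<Lambda> U). h A) - e"
proof (rule ccontr)
  assume "\<not> ?thesis"
  then have "h A \<le> (SUP A\<in>vball (ultrapower TYPE('a) \<Lambda> U). h A) - e"
    if "A \<in> vball (ultrapower TYPE('a) \<Lambda> U)" for A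
    using that by (force simp: vball_eq)
  moreover have "vball (ultrapower TYPE('a) \<Lambda> U) \<noteq> {}"
  proof -
    have "(\<lambda>_. 0) \<in> (uball :: ('i \<Rightarrow> 'a) set)" by (simp add: uball_def)
    then show ?thesis by (auto simp: vball_eq)
  qed
  ultimately have "(SUP A\<in>vball (ultrapower TYPE('a) \<Lambda> U). h A)
      \<le> (SUP A\<in>vball (ultrapower TYPE('a) \<Lambda> U). h A) - e"
    by (intro cSUP_least)
  then show False using e by simp
qed

lemma ultrapower_combination:
  assumes "finite I" "\<And>i. i \<in> I \<Longrightarrow> x i \<in> vball (ultrapower TYPE('a::real_normed_vector) \<Lambda> U)"
  shows "\<exists>w. (\<forall>i\<in>I. w i \<in> uball \<and> x i = ucls (w i)) \<and>
    (\<Oplus>\<^bsub>ultrapower TYPE('a) \<Lambda> U\<^esub>i\<in>I. c i \<odot>\<^bsub>ultrapower TYPE('a) \<Lambda> U\<^esub> x i) =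
      ucls (\<lambda>l. \<Sum>i\<in>I. c i *\<^sub>R w i l)"
proof -
  interpret abelian_group "ultrapower TYPE('a) \<Lambda> U" by (rule abelian_group_ultrapower)
  have "\<exists>f. f \<in> uball \<and> x i = ucls f" if "i \<in> I" for i
    using assms(2)[OF that] by (auto simp: vball_eq)
  then obtain w where w: "\<And>i. i \<in> I \<Longrightarrow> w i \<in> uball \<and> x i = ucls (w i)" by metis
  have b: "bounded (w i ` \<Lambda>)" if "i \<in> I" for i using w[OF that] uball_bounded by blast
  have "(\<Oplus>\<^bsub>ultrapower TYPE('a) \<Lambda> U\<^esub>i\<in>I. c i \<odot>\<^bsub>ultrapower TYPE('a) \<Lambda> U\<^esub> x i) =
      (\<Oplus>\<^bsub>ultrapower TYPE('a) \<Lambda> U\<^esub>i\<in>I. ucls (\<lambda>l. c i *\<^sub>R w i l))"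
    by (rule finsum_cong') (auto simp: w b ucls_smult ucls_in_carrier bounded_image_scale)
  also have "\<dots> = ucls (\<lambda>l. \<Sum>i\<in>I. c i *\<^sub>R w i l)"
    by (rule ucls_finsum) (auto simp: assms b bounded_image_scale)
  finally show ?thesis using w by blast
qed

text \<open>Slices are described by points y i instead of suprema: letting y i nearly maximise
  \<phi> i returns to slices, whereas arbitrary y i are what the separation of a given tuple calls
  for. The n slice conditions are merged into one inequality with total slack \<alpha>, a condition
  on the single functional that sums the \<phi> i over a tuple.\<close>

definition slices_with_large_sum :: "'a::real_normed_vector itself \<Rightarrow> bool" where
  "slices_with_large_sum X \<longleftrightarrow>
     (\<forall>n\<ge>1. \<forall>\<phi> (y :: nat \<Rightarrow> 'i \<Rightarrow> 'a). \<forall>\<alpha>>0. \<forall>\<epsilon>>0.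
        (\<forall>i\<in>{1..n}. ultrafunctional (\<phi> i) \<and> y i \<in> uball) \<longrightarrow>
        (\<exists>w. (\<forall>i\<in>{1..n}. w i \<in> uball) \<and>
           (\<Sum>i\<in>{1..n}. \<phi> i (w i)) > (\<Sum>i\<in>{1..n}. \<phi> i (y i)) - \<alpha> \<and>
           ultranorm (\<lambda>l. \<Sum>i\<in>{1..n}. w i l) > real n * (1 - \<epsilon>)))"

lemma slices_with_large_sumE:
  fixes y :: "nat \<Rightarrow> 'i \<Rightarrow> 'a::real_normed_vector"
  assumes "slices_with_large_sum TYPE('a)" "n \<ge> 1" "\<alpha> > 0" "\<epsilon> > 0"
    and "\<And>i. i \<in> {1..n} \<Longrightarrow> ultrafunctional (\<phi> i)" "\<And>i. i \<in> {1..n} \<Longrightarrow> y i \<in> uball"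
  obtains w where "\<And>i. i \<in> {1..n} \<Longrightarrow> w i \<in> uball"
    "(\<Sum>i\<in>{1..n}. \<phi> i (w i)) > (\<Sum>i\<in>{1..n}. \<phi> i (y i)) - \<alpha>"
    "ultranorm (\<lambda>l. \<Sum>i\<in>{1..n}. w i l) > real n * (1 - \<epsilon>)"
proof -
  have "\<forall>i\<in>{1..n}. ultrafunctional (\<phi> i) \<and> y i \<in> uball" using assms by simp
  from assms(1)[unfolded slices_with_large_sum_def, THEN spec, THEN mp, OF assms(2), THEN spec,
      THEN spec, THEN spec, THEN mp, OF assms(3), THEN spec, THEN mp, OF assms(4), THEN mp, OF this]
  show thesis using that by blast
qed

text \<open>With equal weights 1 / n, a distance close to 2 between two points of the convex
  combination forces one of them to have norm close to 1; multiplied by n, this is the required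
  large sum.\<close>

lemma SD2P_imp_slices_with_large_sum:
  assumes SD: "SD2P (ultrapower TYPE('a::real_normed_vector) \<Lambda> U)"
  shows "slices_with_large_sum TYPE('a)"
  unfolding slices_with_large_sum_def
proof (intro allI impI)
  fix n :: nat and \<phi> :: "nat \<Rightarrow> ('i \<Rightarrow> 'a) \<Rightarrow> real" and y :: "nat \<Rightarrow> 'i \<Rightarrow> 'a" and \<alpha> \<epsilon> :: real
  assume n: "n \<ge> 1" and \<alpha>: "\<alpha> > 0" and \<epsilon>: "\<epsilon> > 0"
    and "\<forall>i\<in>{1..n}. ultrafunctional (\<phi> i) \<and> y i \<in> uball"
  then have \<phi>: "\<And>i. i \<in> {1..n} \<Longrightarrow> ultrafunctional (\<phi> i)" and y: "\<And>i. i \<in> {1..n} \<Longrightarrow> y i \<in> uball"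
    by auto
  let ?V = "ultrapower TYPE('a) \<Lambda> U"
  have "\<exists>h. h \<in> dual ?V \<and> (\<forall>f. bounded (f ` \<Lambda>) \<longrightarrow> h (ucls f) = \<phi> i f)" if "i \<in> {1..n}" for i
    using ultrafunctional_dual[OF \<phi>[OF that]] by blast
  then obtain h where h: "\<And>i. i \<in> {1..n} \<Longrightarrow> h i \<in> dual ?V"
    and h\<phi>: "\<And>i f. i \<in> {1..n} \<Longrightarrow> bounded (f ` \<Lambda>) \<Longrightarrow> h i (ucls f) = \<phi> i f"
    by metis
  \<comment> \<open>The width \<alpha> / n makes the n losses add up to \<alpha>.\<close>
  define S where "S i = slice ?V (h i) (\<alpha> / n)" for i
  define C where "C = {\<Oplus>\<^bsub>?V\<^esub>i\<in>{1..n}. (1 / real n) \<odot>\<^bsub>?V\<^esub> x i | x. \<forall>i\<in>{1..n}. x i \<in> S i}"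
  have "convex_comb_of_slices ?V C"
    unfolding convex_comb_of_slices_def
  proof (intro exI conjI)
    show "\<forall>i\<in>{1..n}. 1 / real n > 0 \<and> is_slice ?V (S i)"
      using n h \<alpha> by (auto simp: is_slice_def S_def intro!: bexI[of _ "h _"] exI[of _ "\<alpha> / n"])
  qed (use n in \<open>auto simp: C_def\<close>)
  then have "ereal (2 - 2 * \<epsilon>) < vdiameter ?V C"
    using SD \<epsilon> by (simp add: SD2P_def)
  then obtain A B where A: "A \<in> C" and B: "B \<in> C" and AB: "2 - 2 * \<epsilon> < vnorm ?V (A \<ominus>\<^bsub>?V\<^esub> B)"
    by (auto simp: vdiameter_def less_SUP_iff)
  have repr: "\<exists>w. (\<forall>i\<in>{1..n}. w i \<in> uball) \<and> A = ucls (\<lambda>l. \<Sum>i\<in>{1..n}. (1 / real n) *\<^sub>R w i l) \<and>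
      (\<Sum>i\<in>{1..n}. \<phi> i (w i)) > (\<Sum>i\<in>{1..n}. \<phi> i (y i)) - \<alpha>" if A: "A \<in> C" for A
  proof -
    obtain x where x: "\<And>i. i \<in> {1..n} \<Longrightarrow> x i \<in> S i"
      and Ax: "A = (\<Oplus>\<^bsub>?V\<^esub>i\<in>{1..n}. (1 / real n) \<odot>\<^bsub>?V\<^esub> x i)"
      using A unfolding C_def by blast
    have "x i \<in> vball ?V" if "i \<in> {1..n}" for i using x[OF that] by (simp add: S_def slice_def)
    then obtain w where w: "\<forall>i\<in>{1..n}. w i \<in> uball \<and> x i = ucls (w i)"
      and Aw: "A = ucls (\<lambda>l. \<Sum>i\<in>{1..n}. (1 / real n) *\<^sub>R w i l)"
      using ultrapower_combination[of "{1..n}" x "\<lambda>_. 1 / real n"] unfolding Ax by auto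
    have "(\<Sum>i\<in>{1..n}. \<phi> i (y i) - \<alpha> / n) < (\<Sum>i\<in>{1..n}. \<phi> i (w i))"
    proof (rule sum_strict_mono)
      fix i assume i: "i \<in> {1..n}"
      have "h i (ucls (w i)) > (SUP A\<in>vball ?V. h i A) - \<alpha> / n"
        using x[OF i] w i by (simp add: S_def slice_def)
      then show "\<phi> i (y i) - \<alpha> / n < \<phi> i (w i)"
        using ultrafunctional_le_SUP[OF h[OF i] y[OF i]] h\<phi>[OF i uball_bounded[OF y[OF i]]]
          h\<phi>[OF i uball_bounded, of "w i"] w i by simp
    qed (use n in auto)
    then show ?thesis using w Aw n by (auto simp: sum_subtractf)
  qed
  obtain u where u: "\<forall>i\<in>{1..n}. u i \<in> uball" "A = ucls (\<lambda>l. \<Sum>i\<in>{1..n}. (1 / real n) *\<^sub>R u i l)"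
      "(\<Sum>i\<in>{1..n}. \<phi> i (u i)) > (\<Sum>i\<in>{1..n}. \<phi> i (y i)) - \<alpha>"
    using repr[OF A] by auto
  obtain v where v: "\<forall>i\<in>{1..n}. v i \<in> uball" "B = ucls (\<lambda>l. \<Sum>i\<in>{1..n}. (1 / real n) *\<^sub>R v i l)"
      "(\<Sum>i\<in>{1..n}. \<phi> i (v i)) > (\<Sum>i\<in>{1..n}. \<phi> i (y i)) - \<alpha>"
    using repr[OF B] by auto
  define N where "N w = ultranorm (\<lambda>l. \<Sum>i\<in>{1..n}. w i l)" for w :: "nat \<Rightarrow> 'i \<Rightarrow> 'a"
  have b: "bounded ((\<lambda>l. \<Sum>i\<in>{1..n}. w i l) ` \<Lambda>)" if "\<forall>i\<in>{1..n}. w i \<in> uball" for w :: "nat \<Rightarrow> 'i \<Rightarrow> 'a"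
    using that by (intro bounded_image_sum) (auto intro: uball_bounded)
  have "2 - 2 * \<epsilon> < ultranorm (\<lambda>l. (1 / real n) *\<^sub>R (\<Sum>i\<in>{1..n}. u i l) - (1 / real n) *\<^sub>R (\<Sum>i\<in>{1..n}. v i l))"
    using AB b[OF u(1)] b[OF v(1)] unfolding u(2) v(2)
    by (simp add: ucls_minus ucls_vnorm bounded_image_scale bounded_image_diff flip: scaleR_sum_right)
  also have "\<dots> \<le> (1 / real n) * N u + (1 / real n) * N v"
    using ultranorm_diff[OF bounded_image_scale[OF b[OF u(1)]] bounded_image_scale[OF b[OF v(1)]], of "1 / real n" "1 / real n"]
      ultranorm_scale[OF b[OF u(1)]] ultranorm_scale[OF b[OF v(1)]]
    by (simp add: N_def)
  finally have "2 * (real n * (1 - \<epsilon>)) < N u + N v"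
    using n by (simp add: field_simps)
  then have "real n * (1 - \<epsilon>) < N u \<or> real n * (1 - \<epsilon>) < N v" by linarith
  then show "\<exists>w. (\<forall>i\<in>{1..n}. w i \<in> uball) \<and>
           (\<Sum>i\<in>{1..n}. \<phi> i (w i)) > (\<Sum>i\<in>{1..n}. \<phi> i (y i)) - \<alpha> \<and>
           ultranorm (\<lambda>l. \<Sum>i\<in>{1..n}. w i l) > real n * (1 - \<epsilon>)"
    using u v unfolding N_def by blast
qed

text \<open>Slices \<open>S\<^sub>i\<close> and their reflections \<open>- S\<^sub>i\<close> are treated together, so that a large sum of
  \<open>2n\<close> elements becomes a large difference of two elements of the convex combination.
  A sum of norm close to the number of its terms stays large for arbitrary weights.\<close>

lemma slices_with_large_sum_imp_SD2P:
  assumes large: "slices_with_large_sum TYPE('a::real_normed_vector)"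
  shows "SD2P (ultrapower TYPE('a) \<Lambda> U)"
  unfolding SD2P_def
proof (intro allI impI order.antisym)
  let ?V = "ultrapower TYPE('a) \<Lambda> U"
  fix C assume "convex_comb_of_slices ?V C"
  then obtain n :: nat and c S where n: "n \<ge> 1" and c: "\<And>i. i \<in> {1..n} \<Longrightarrow> c i > 0"
    and "\<And>i. i \<in> {1..n} \<Longrightarrow> is_slice ?V (S i)" and c1: "(\<Sum>i\<in>{1..n}. c i) = 1"
    and C: "C = {\<Oplus>\<^bsub>?V\<^esub>i\<in>{1..n}. c i \<odot>\<^bsub>?V\<^esub> x i | x. \<forall>i\<in>{1..n}. x i \<in> S i}"
    unfolding convex_comb_of_slices_def by blast
  then have "\<forall>i\<in>{1..n}. \<exists>h a. h \<in> dual ?V \<and> a > 0 \<and> S i = slice ?V h a"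
    unfolding is_slice_def by blast
  then obtain h a where h: "\<And>i. i \<in> {1..n} \<Longrightarrow> h i \<in> dual ?V" and a: "\<And>i. i \<in> {1..n} \<Longrightarrow> a i > 0"
    and S: "\<And>i. i \<in> {1..n} \<Longrightarrow> S i = slice ?V (h i) (a i)"
    by metis
  show "vdiameter ?V C \<le> 2"
    unfolding vdiameter_def
  proof (intro SUP_least)
    have repr: "\<exists>w. bounded (w ` \<Lambda>) \<and> A = ucls w \<and> ultranorm w \<le> 1" if A: "A \<in> C" for A
    proof -
      obtain x where x: "\<And>i. i \<in> {1..n} \<Longrightarrow> x i \<in> S i"
        and Ax: "A = (\<Oplus>\<^bsub>?V\<^esub>i\<in>{1..n}. c i \<odot>\<^bsub>?V\<^esub> x i)"
        using A unfolding C by blast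
      have "x i \<in> vball ?V" if "i \<in> {1..n}" for i using x[OF that] S[OF that] by (simp add: slice_def)
      then obtain w where w: "\<forall>i\<in>{1..n}. w i \<in> uball \<and> x i = ucls (w i)"
        and Aw: "A = ucls (\<lambda>l. \<Sum>i\<in>{1..n}. c i *\<^sub>R w i l)"
        using ultrapower_combination[of "{1..n}" x c] unfolding Ax by auto
      have b: "bounded (w i ` \<Lambda>)" if "i \<in> {1..n}" for i using w that uball_bounded by blast
      have "ultranorm (\<lambda>l. \<Sum>i\<in>{1..n}. c i *\<^sub>R w i l) \<le> (\<Sum>i\<in>{1..n}. ultranorm (\<lambda>l. c i *\<^sub>R w i l))"
        by (intro ultranorm_sum bounded_image_scale b)
      also have "\<dots> \<le> (\<Sum>i\<in>{1..n}. c i)"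
      proof (rule sum_mono)
        fix i assume i: "i \<in> {1..n}"
        show "ultranorm (\<lambda>l. c i *\<^sub>R w i l) \<le> c i"
          using w i c[OF i] mult_left_mono[OF uball_ultranorm, of "w i" "c i"]
          by (simp add: ultranorm_scale[OF b[OF i]])
      qed
      finally show ?thesis
        using Aw c1 by (auto intro!: exI[of _ "\<lambda>l. \<Sum>i\<in>{1..n}. c i *\<^sub>R w i l"] bounded_image_sum bounded_image_scale b)
    qed
    fix A B assume "A \<in> C" "B \<in> C"
    then obtain v w where vw: "bounded (v ` \<Lambda>)" "A = ucls v" "ultranorm v \<le> 1"
        "bounded (w ` \<Lambda>)" "B = ucls w" "ultranorm w \<le> 1"
      using repr by meson
    then have "vnorm ?V (A \<ominus>\<^bsub>?V\<^esub> B) \<le> 2"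
      using ultranorm_diff[of v w] by (simp add: ucls_minus ucls_vnorm bounded_image_diff)
    then show "ereal (vnorm ?V (A \<ominus>\<^bsub>?V\<^esub> B)) \<le> 2"
      by (metis ereal_less_eq(3) numeral_eq_ereal)
  qed
  \<comment> \<open>The indices i and n + i both refer to \<open>S i\<close>: the first to the slice
    itself, the second to its reflection, which is cut out by the functional
    \<open>- h i\<close>.\<close>
  define idx where "idx j = (if j \<le> n then j else j - n)" for j
  define \<phi> where "\<phi> j = (if j \<le> n then (\<lambda>f. h j (ucls f)) else (\<lambda>f. - h (j - n) (ucls f)))" for j
  \<comment> \<open>The ball is symmetric, so \<open>h i\<close> and \<open>- h i\<close> have the
    same supremum on it; this is why no sign occurs here.\<close>
  define s where "s j = (SUP A\<in>vball ?V. h (idx j) A)" for j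
  \<comment> \<open>Two losses of \<alpha> will occur, one because the points \<open>y\<close> miss
    the suprema and one in passing from \<open>y\<close> to \<open>w\<close>; together they must not
    exceed any of the widths \<open>a i\<close>.\<close>
  define \<alpha> where "\<alpha> = Min (a ` {1..n}) / 2"
  have \<alpha>: "\<alpha> > 0" and \<alpha>a: "\<And>i. i \<in> {1..n} \<Longrightarrow> 2 * \<alpha> \<le> a i"
    using n a by (auto simp: \<alpha>_def)
  have idx: "idx j \<in> {1..n}" if "j \<in> {1..2 * n}" for j using that by (auto simp: idx_def)
  have \<phi>: "ultrafunctional (\<phi> j)" if "j \<in> {1..2 * n}" for j
    using dual_ucls[OF h[OF idx[OF that]]] ultrafunctional_minus
    by (auto simp: \<phi>_def idx_def split: if_splits)
  have \<phi>_s: "\<phi> j f \<le> s j" if "j \<in> {1..2 * n}" "f \<in> uball" for j f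
    using ultrafunctional_le_SUP[OF h[OF idx[OF that(1)]] that(2)]
      ultrafunctional_le_SUP[OF h[OF idx[OF that(1)]] uball_uminus[OF that(2)]]
      ultrafunctional_uminus[OF dual_ucls[OF h[OF idx[OF that(1)]]] uball_bounded[OF that(2)]]
    by (auto simp: \<phi>_def idx_def s_def)
  have "\<exists>y\<in>uball. \<phi> j y > s j - \<alpha> / (2 * n)" if j: "j \<in> {1..2 * n}" for j
  proof -
    obtain y where y: "y \<in> uball" "h (idx j) (ucls y) > s j - \<alpha> / (2 * n)"
      using less_SUP_vball[OF h[OF idx[OF j]], of "\<alpha> / (2 * n)"] \<alpha> n by (auto simp: s_def)
    then show ?thesis
      using ultrafunctional_uminus[OF dual_ucls[OF h[OF idx[OF j]]] uball_bounded[OF y(1)]]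
        uball_uminus[OF y(1)]
      by (cases "j \<le> n") (auto simp: \<phi>_def idx_def intro: bexI[of _ y] bexI[of _ "\<lambda>i. - y i"])
  qed
  then obtain y where y: "\<And>j. j \<in> {1..2 * n} \<Longrightarrow> y j \<in> uball"
    and \<phi>_y: "\<And>j. j \<in> {1..2 * n} \<Longrightarrow> \<phi> j (y j) > s j - \<alpha> / (2 * n)"
    by metis
  show "2 \<le> vdiameter ?V C"
  proof (rule ereal_le_epsilon2)
    fix e :: real assume e: "e > 0"
    obtain w where w: "\<And>j. j \<in> {1..2 * n} \<Longrightarrow> w j \<in> uball"
      and \<phi>_w: "(\<Sum>j\<in>{1..2 * n}. \<phi> j (w j)) > (\<Sum>j\<in>{1..2 * n}. \<phi> j (y j)) - \<alpha>"
      and norm_w: "ultranorm (\<lambda>l. \<Sum>j\<in>{1..2 * n}. w j l) > real (2 * n) * (1 - e / (2 * n))"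
    proof -
      have n2: "1 \<le> 2 * n" and e2: "e / real (2 * n) > 0" using n e by auto
      show ?thesis
        by (rule slices_with_large_sumE[OF large n2 \<alpha> e2, of \<phi> y]) (fact \<phi> y that)+
    qed
    \<comment> \<open>No other term exceeds its supremum, so the deficit of one term is at most the
      total deficit, which is below 2 \<alpha>.\<close>
    have in_slice: "\<phi> j (w j) > s j - a (idx j)" if j: "j \<in> {1..2 * n}" for j
    proof -
      have "(\<Sum>k\<in>{1..2 * n}. s k - \<alpha> / (2 * n)) < (\<Sum>k\<in>{1..2 * n}. \<phi> k (y k))"
        using n \<phi>_y by (intro sum_strict_mono) auto
      then have "(\<Sum>k\<in>{1..2 * n}. s k) - 2 * \<alpha> < (\<Sum>k\<in>{1..2 * n}. \<phi> k (w k))"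
        using \<phi>_w n by (simp add: sum_subtractf)
      moreover have "(\<Sum>k\<in>{1..2 * n} - {j}. \<phi> k (w k)) \<le> (\<Sum>k\<in>{1..2 * n} - {j}. s k)"
        using \<phi>_s w by (intro sum_mono) auto
      ultimately have "\<phi> j (w j) > s j - 2 * \<alpha>"
        using j sum.remove[of "{1..2 * n}" j s] sum.remove[of "{1..2 * n}" j "\<lambda>k. \<phi> k (w k)"]
        by simp
      then show ?thesis using \<alpha>a[OF idx[OF j]] by simp
    qed
    define u v where "u i = w i" and "v i = (\<lambda>l. - w (n + i) l)" for i
    have u: "u i \<in> uball" "ucls (u i) \<in> S i" if i: "i \<in> {1..n}" for i
      using w[of i] in_slice[of i] i
      by (auto simp: u_def S slice_def vball_eq \<phi>_def idx_def s_def)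
    have v: "v i \<in> uball" "ucls (v i) \<in> S i" if i: "i \<in> {1..n}" for i
    proof -
      have ni: "n + i \<in> {1..2 * n}" "\<not> n + i \<le> n" using i by auto
      show "v i \<in> uball" using uball_uminus[OF w[OF ni(1)]] by (simp add: v_def)
      moreover have "h i (ucls (v i)) = \<phi> (n + i) (w (n + i))"
        using ultrafunctional_uminus[OF dual_ucls[OF h[OF i]] uball_bounded[OF w[OF ni(1)]]] ni(2)
        by (simp add: v_def \<phi>_def)
      ultimately show "ucls (v i) \<in> S i"
        using in_slice[OF ni(1)] ni(2) S[OF i] by (simp add: slice_def vball_eq idx_def s_def)
    qed
    have bu: "bounded (u i ` \<Lambda>)" and bv: "bounded (v i ` \<Lambda>)" if "i \<in> {1..n}" for i
      using u(1)[OF that] v(1)[OF that] uball_bounded by auto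
    have comb: "ucls (\<lambda>l. \<Sum>i\<in>{1..n}. c i *\<^sub>R x i l) \<in> C"
      if x: "\<And>i. i \<in> {1..n} \<Longrightarrow> x i \<in> uball" "\<And>i. i \<in> {1..n} \<Longrightarrow> ucls (x i) \<in> S i" for x
    proof -
      interpret abelian_group ?V by (rule abelian_group_ultrapower)
      have b: "bounded (x i ` \<Lambda>)" if "i \<in> {1..n}" for i using x(1)[OF that] by (rule uball_bounded)
      have "ucls (\<lambda>l. \<Sum>i\<in>{1..n}. c i *\<^sub>R x i l) = (\<Oplus>\<^bsub>?V\<^esub>i\<in>{1..n}. ucls (\<lambda>l. c i *\<^sub>R x i l))"
        by (rule ucls_finsum[symmetric]) (simp_all add: b bounded_image_scale)
      also have "\<dots> = (\<Oplus>\<^bsub>?V\<^esub>i\<in>{1..n}. c i \<odot>\<^bsub>?V\<^esub> ucls (x i))"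
        by (rule finsum_cong') (auto simp: b ucls_smult ucls_in_carrier bounded_image_scale)
      finally show ?thesis
        using x(2) unfolding C by (intro CollectI exI[of _ "\<lambda>i. ucls (x i)"]) simp
    qed
    have b: "bounded ((\<lambda>l. d i *\<^sub>R (u i l - v i l)) ` \<Lambda>)" if "i \<in> {1..n}" for i and d :: "nat \<Rightarrow> real"
      by (intro bounded_image_scale bounded_image_diff bu bv that)
    have c_le: "c i \<le> 1" if "i \<in> {1..n}" for i
      using member_le_sum[of i "{1..n}" c] that c c1 by (force intro: less_imp_le)
    \<comment> \<open>The sum of all u i - v i has norm above 2 n - e. The part weighted by 1 - c i
      has norm at most 2 n - 2, because the c i add up to 1; this leaves at least 2 - e for the part
      weighted by c i.\<close>
    have "2 * real n - e < ultranorm (\<lambda>l. \<Sum>j\<in>{1..2 * n}. w j l)"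
      using norm_w n by (simp add: right_diff_distrib)
    also have "(\<lambda>l. \<Sum>j\<in>{1..2 * n}. w j l) =
        (\<lambda>l. (\<Sum>i\<in>{1..n}. c i *\<^sub>R (u i l - v i l)) + (\<Sum>i\<in>{1..n}. (1 - c i) *\<^sub>R (u i l - v i l)))"
      unfolding sum_double u_def v_def sum.distrib[symmetric] by (simp add: algebra_simps)
    also have "ultranorm \<dots> \<le> ultranorm (\<lambda>l. \<Sum>i\<in>{1..n}. c i *\<^sub>R (u i l - v i l)) +
        ultranorm (\<lambda>l. \<Sum>i\<in>{1..n}. (1 - c i) *\<^sub>R (u i l - v i l))"
      by (intro ultranorm_add bounded_image_sum b)
    also have "ultranorm (\<lambda>l. \<Sum>i\<in>{1..n}. (1 - c i) *\<^sub>R (u i l - v i l)) \<le>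
        (\<Sum>i\<in>{1..n}. ultranorm (\<lambda>l. (1 - c i) *\<^sub>R (u i l - v i l)))"
      by (intro ultranorm_sum b)
    also have "\<dots> \<le> (\<Sum>i\<in>{1..n}. (1 - c i) * 2)"
    proof (rule sum_mono)
      fix i assume i: "i \<in> {1..n}"
      have "ultranorm (\<lambda>l. u i l - v i l) \<le> 2"
        using ultranorm_diff[OF bu[OF i] bv[OF i]] uball_ultranorm[OF u(1)[OF i]]
          uball_ultranorm[OF v(1)[OF i]] by simp
      then show "ultranorm (\<lambda>l. (1 - c i) *\<^sub>R (u i l - v i l)) \<le> (1 - c i) * 2"
        using c_le[OF i] mult_left_mono[of "ultranorm (\<lambda>l. u i l - v i l)" 2 "1 - c i"]
        by (simp add: ultranorm_scale[OF bounded_image_diff[OF bu[OF i] bv[OF i]]])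
    qed
    also have "\<dots> = 2 * real n - 2"
      using c1 by (simp add: sum_subtractf flip: sum_distrib_right)
    finally have le: "2 - e \<le> ultranorm (\<lambda>l. \<Sum>i\<in>{1..n}. c i *\<^sub>R (u i l - v i l))" by simp
    have sums: "bounded ((\<lambda>l. \<Sum>i\<in>{1..n}. c i *\<^sub>R u i l) ` \<Lambda>)"
      "bounded ((\<lambda>l. \<Sum>i\<in>{1..n}. c i *\<^sub>R v i l) ` \<Lambda>)"
      by (intro bounded_image_sum bounded_image_scale bu bv; assumption)+
    note le
    also have "ultranorm (\<lambda>l. \<Sum>i\<in>{1..n}. c i *\<^sub>R (u i l - v i l)) =
        vnorm ?V (ucls (\<lambda>l. \<Sum>i\<in>{1..n}. c i *\<^sub>R u i l) \<ominus>\<^bsub>?V\<^esub> ucls (\<lambda>l. \<Sum>i\<in>{1..n}. c i *\<^sub>R v i l))"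
      unfolding ucls_minus[OF sums] ucls_vnorm[OF bounded_image_diff[OF sums]]
      by (simp add: scaleR_diff_right sum_subtractf)
    finally have "ereal (2 - e) \<le> vdiameter ?V C"
      unfolding vdiameter_def by (intro SUP_upper2[OF comb[OF u]] SUP_upper2[OF comb[OF v]]) simp_all
    then show "2 \<le> vdiameter ?V C + ereal e"
      using add_right_mono[of "ereal (2 - e)" "vdiameter ?V C" "ereal e"] by simp
  qed
qed

end


section \<open>The quantities \<open>Dparam\<close> in elementary terms\<close>

text \<open>Exactly m terms with possibly vanishing weights replace at most m terms. The last
  inequality is strict because it is to express that an infimum of distances lies below \<delta>.
  Only the values at {1..n} enter, so tuples need not be extensional.\<close>

definition convex_approx ::
    "nat \<Rightarrow> nat \<Rightarrow> real \<Rightarrow> real \<Rightarrow> real \<Rightarrow> (nat \<Rightarrow> 'a::real_normed_vector) \<Rightarrow> bool" where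
  "convex_approx n m \<epsilon> \<alpha> \<delta> z \<longleftrightarrow> (\<exists>c x.
     (\<forall>j\<in>{1..m}. c j \<ge> 0 \<and> (\<forall>i\<in>{1..n}. norm (x j i) \<le> \<alpha>) \<and>
        norm (\<Sum>i\<in>{1..n}. x j i) > real n * (1 - \<epsilon>)) \<and>
     (\<Sum>j\<in>{1..m}. c j) = 1 \<and>
     (\<forall>i\<in>{1..n}. norm (z i - (\<Sum>j\<in>{1..m}. c j *\<^sub>R x j i)) < \<delta>))"

lemma convex_approx_mono:
  assumes "convex_approx n k \<epsilon> \<alpha> \<delta> z" "k \<le> m" "\<alpha> \<le> \<beta>"
  shows "convex_approx n m \<epsilon> \<beta> \<delta> z"
proof -
  obtain c x where cx: "\<And>j. j \<in> {1..k} \<Longrightarrow> c j \<ge> (0::real)"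
      "\<And>j i. j \<in> {1..k} \<Longrightarrow> i \<in> {1..n} \<Longrightarrow> norm (x j i) \<le> \<alpha>"
      "\<And>j. j \<in> {1..k} \<Longrightarrow> norm (\<Sum>i\<in>{1..n}. x j i) > real n * (1 - \<epsilon>)"
      "(\<Sum>j\<in>{1..k}. c j) = 1"
      "\<And>i. i \<in> {1..n} \<Longrightarrow> norm (z i - (\<Sum>j\<in>{1..k}. c j *\<^sub>R x j i)) < \<delta>"
    using assms(1) unfolding convex_approx_def by blast
  have x_le: "norm (x j i) \<le> \<beta>" if "j \<in> {1..k}" "i \<in> {1..n}" for j i
    using cx(2)[OF that] assms(3) by simp
  \<comment> \<open>Weights with sum 1 require a first term; copies of it with weight zero fill the
    positions beyond k.\<close>
  have "k \<noteq> 0" using cx(4) by (intro notI) simp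
  then have k: "1 \<in> {1..k}" by auto
  define d where "d j = (if j \<le> k then c j else 0)" for j
  define y where "y j = (if j \<le> k then x j else x 1)" for j
  have "(\<Sum>j\<in>{1..m}. d j) = (\<Sum>j\<in>{1..k}. c j)"
    using assms(2) by (intro sum.mono_neutral_cong_right) (auto simp: d_def)
  moreover have "(\<Sum>j\<in>{1..m}. d j *\<^sub>R y j i) = (\<Sum>j\<in>{1..k}. c j *\<^sub>R x j i)" for i
    using assms(2) by (intro sum.mono_neutral_cong_right) (auto simp: d_def y_def)
  moreover have "d j \<ge> 0 \<and> (\<forall>i\<in>{1..n}. norm (y j i) \<le> \<beta>) \<and> norm (\<Sum>i\<in>{1..n}. y j i) > real n * (1 - \<epsilon>)"
    if "j \<in> {1..m}" for j
    using that cx(1,3)[of j] cx(3)[OF k] x_le[of j] x_le[OF k] by (auto simp: d_def y_def)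
  ultimately show ?thesis
    using cx(4,5) unfolding convex_approx_def by (intro exI[of _ d] exI[of _ y]) simp
qed

lemma vnorm_linf_le:
  "n \<ge> 1 \<Longrightarrow> vnorm (linf {1..n}) z \<le> \<alpha> \<longleftrightarrow> (\<forall>i\<in>{1..n}. norm (z i) \<le> \<alpha>)" for n :: nat
  by (simp add: linf_simps cSup_eq_Max)

lemma vnorm_linf_less:
  "n \<ge> 1 \<Longrightarrow> vnorm (linf {1..n}) z < \<alpha> \<longleftrightarrow> (\<forall>i\<in>{1..n}. norm (z i) < \<alpha>)" for n :: nat
  by (simp add: linf_simps cSup_eq_Max)

lemma carrier_linf_finite: "finite I \<Longrightarrow> carrier (linf I) = extensional I"
  by (auto simp: linf_simps finite_imp_bounded)

text \<open>An infimum is below \<delta> exactly if one of the distances is. For m = 0 both sides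
  fail: the set is empty and its distance infinite, and an empty sum of weights is not 1.\<close>

lemma vsetdist_Cset_less:
  fixes z :: "nat \<Rightarrow> 'a::real_normed_vector"
  assumes n: "n \<ge> 1" and z: "z \<in> carrier (linf {1..n})"
  shows "vsetdist (linf {1..n}) z (Cset n m \<epsilon> \<alpha>) < ereal \<delta> \<longleftrightarrow> convex_approx n m \<epsilon> \<alpha> \<delta> z"
proof -
  let ?L = "linf {1..n} :: (nat \<Rightarrow> 'a) nspace"
  define K :: "(nat \<Rightarrow> 'a) set" where
    "K = {z \<in> carrier ?L. vnorm ?L z \<le> \<alpha> \<and> (1 / real n) * norm (\<Sum>i\<in>{1..n}. z i) > 1 - \<epsilon>}"
  have K: "x \<in> K \<longleftrightarrow> x \<in> extensional {1..n} \<and> (\<forall>i\<in>{1..n}. norm (x i) \<le> \<alpha>) \<and>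
      norm (\<Sum>i\<in>{1..n}. x i) > real n * (1 - \<epsilon>)" for x
    using n unfolding K_def mem_Collect_eq vnorm_linf_le[OF n] by (simp add: carrier_linf_finite field_simps)
  have comb: "(\<Oplus>\<^bsub>?L\<^esub>j\<in>{1..k}. c j \<odot>\<^bsub>?L\<^esub> x j) = (\<lambda>i\<in>{1..n}. \<Sum>j\<in>{1..k}. c j *\<^sub>R x j i)"
    for k :: nat and c x
  proof -
    have "(\<Oplus>\<^bsub>?L\<^esub>j\<in>{1..k}. c j \<odot>\<^bsub>?L\<^esub> x j) = (\<lambda>i\<in>{1..n}. \<Sum>j\<in>{1..k}. (c j \<odot>\<^bsub>?L\<^esub> x j) i)"
      by (rule linf_finsum) (simp_all add: carrier_linf_finite, simp add: linf_simps)
    then show ?thesis by (simp add: linf_simps cong: restrict_cong)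
  qed
  have C: "Cset n m \<epsilon> \<alpha> = {(\<lambda>i\<in>{1..n}. \<Sum>j\<in>{1..k}. c j *\<^sub>R x j i) | k (c :: nat \<Rightarrow> real) x.
      1 \<le> k \<and> k \<le> m \<and> (\<forall>j\<in>{1..k}. c j \<ge> 0 \<and> x j \<in> K) \<and> (\<Sum>j\<in>{1..k}. c j) = 1}"
    unfolding Cset_def convex_combs_upto_def K_def[symmetric] comb ..
  have dist: "vnorm ?L (z \<ominus>\<^bsub>?L\<^esub> (\<lambda>i\<in>{1..n}. y i)) < \<delta> \<longleftrightarrow> (\<forall>i\<in>{1..n}. norm (z i - y i) < \<delta>)" for y
  proof -
    have "restrict y {1..n} \<in> carrier ?L" by (simp add: carrier_linf_finite)
    then show ?thesis
      unfolding vnorm_linf_less[OF n] linf_minus[OF z \<open>restrict y {1..n} \<in> carrier ?L\<close>] by simp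
  qed
  show ?thesis
  proof
    assume "vsetdist ?L z (Cset n m \<epsilon> \<alpha>) < ereal \<delta>"
    then obtain y where y: "y \<in> Cset n m \<epsilon> \<alpha>" "vnorm ?L (z \<ominus>\<^bsub>?L\<^esub> y) < \<delta>"
      by (auto simp: vsetdist_def INF_less_iff)
    then obtain k and c :: "nat \<Rightarrow> real" and x where
      "k \<le> m" "\<forall>j\<in>{1..k}. c j \<ge> 0 \<and> x j \<in> K" "(\<Sum>j\<in>{1..k}. c j) = 1"
      "y = (\<lambda>i\<in>{1..n}. \<Sum>j\<in>{1..k}. c j *\<^sub>R x j i)"
      unfolding C by blast
    then show "convex_approx n m \<epsilon> \<alpha> \<delta> z"
      using y(2) dist K
      by (intro convex_approx_mono[of n k \<epsilon> \<alpha> \<delta> z m \<alpha>])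
         (auto simp: convex_approx_def intro!: exI[of _ c] exI[of _ x])
  next
    assume "convex_approx n m \<epsilon> \<alpha> \<delta> z"
    then obtain c x where cx: "\<And>j. j \<in> {1..m} \<Longrightarrow> c j \<ge> (0::real)"
      "\<And>j i. j \<in> {1..m} \<Longrightarrow> i \<in> {1..n} \<Longrightarrow> norm (x j i) \<le> \<alpha>"
      "\<And>j. j \<in> {1..m} \<Longrightarrow> norm (\<Sum>i\<in>{1..n}. x j i) > real n * (1 - \<epsilon>)"
      "(\<Sum>j\<in>{1..m}. c j) = 1"
      "\<And>i. i \<in> {1..n} \<Longrightarrow> norm (z i - (\<Sum>j\<in>{1..m}. c j *\<^sub>R x j i)) < \<delta>"
      unfolding convex_approx_def by blast
    define y where "y = (\<lambda>i\<in>{1..n}. \<Sum>j\<in>{1..m}. c j *\<^sub>R x j i)"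
    have "m \<noteq> 0" using cx(4) by (intro notI) simp
    moreover have "restrict (x j) {1..n} \<in> K" if "j \<in> {1..m}" for j
      using cx(2,3)[OF that] by (simp add: K)
    moreover have "y = (\<lambda>i\<in>{1..n}. \<Sum>j\<in>{1..m}. c j *\<^sub>R restrict (x j) {1..n} i)"
      by (auto simp: y_def)
    ultimately have "y \<in> Cset n m \<epsilon> \<alpha>"
      using cx(1,4) unfolding C
      by (intro CollectI exI[of _ m] exI[of _ c] exI[of _ "\<lambda>j. restrict (x j) {1..n}"]) simp
    moreover have "vnorm ?L (z \<ominus>\<^bsub>?L\<^esub> y) < \<delta>" using cx(5) dist by (simp add: y_def)
    ultimately show "vsetdist ?L z (Cset n m \<epsilon> \<alpha>) < ereal \<delta>"
      by (auto simp: vsetdist_def INF_less_iff)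
  qed
qed

lemma convex_approx_cong:
  "(\<And>i. i \<in> {1..n} \<Longrightarrow> z i = z' i) \<Longrightarrow> convex_approx n m \<epsilon> \<alpha> \<delta> z = convex_approx n m \<epsilon> \<alpha> \<delta> z'"
  by (simp add: convex_approx_def)

text \<open>The zero tuple keeps the supremum from ranging over the empty set, where its extended
  real value would be negative.\<close>

lemma Dparam_nonneg:
  fixes X :: "'a::real_normed_vector itself"
  assumes n: "n \<ge> 1"
  shows "0 \<le> Dparam X n m \<epsilon> \<alpha>"
proof -
  let ?L = "linf {1..n} :: (nat \<Rightarrow> 'a) nspace"
  have "(\<lambda>i\<in>{1..n}. 0) \<in> vball ?L"
    by (simp add: vball_def vnorm_linf_le[OF n] carrier_linf_finite del: One_nat_def)
  moreover have "0 \<le> vsetdist ?L z C" for z C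
  proof -
    have "0 \<le> vnorm ?L f" for f
      using n vnorm_linf_less[of n f 0] by (metis atLeastAtMost_iff linorder_not_le norm_ge_zero order_refl)
    then show ?thesis by (auto simp: vsetdist_def intro!: INF_greatest)
  qed
  ultimately show ?thesis unfolding Dparam_def by (rule SUP_upper2)
qed

text \<open>Allowing more terms can only help, by \<open>convex_approx_mono\<close>, so one good m
  serves for all larger k. The point of the right-hand side is that m is chosen before z.\<close>

lemma Dparam_tendsto_0_iff:
  fixes X :: "'a::real_normed_vector itself"
  assumes n: "n \<ge> 1"
  shows "(\<lambda>k. Dparam X n k \<epsilon> \<alpha>) \<longlonglongrightarrow> 0 \<longleftrightarrow>
    (\<forall>\<delta>>0. \<exists>m. \<forall>z :: nat \<Rightarrow> 'a. (\<forall>i\<in>{1..n}. norm (z i) \<le> 1) \<longrightarrow> convex_approx n m \<epsilon> \<alpha> \<delta> z)"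
proof
  let ?L = "linf {1..n} :: (nat \<Rightarrow> 'a) nspace"
  assume lim: "(\<lambda>k. Dparam X n k \<epsilon> \<alpha>) \<longlonglongrightarrow> 0"
  show "\<forall>\<delta>>0. \<exists>m. \<forall>z :: nat \<Rightarrow> 'a. (\<forall>i\<in>{1..n}. norm (z i) \<le> 1) \<longrightarrow> convex_approx n m \<epsilon> \<alpha> \<delta> z"
  proof (intro allI impI)
    fix \<delta> :: real assume "\<delta> > 0"
    then have "\<forall>\<^sub>F k in sequentially. Dparam X n k \<epsilon> \<alpha> < ereal \<delta>"
      by (intro order_tendstoD(2)[OF lim]) simp
    then obtain m where m: "Dparam X n m \<epsilon> \<alpha> < ereal \<delta>"
      by (auto simp: eventually_sequentially)
    have "convex_approx n m \<epsilon> \<alpha> \<delta> z" if z: "\<forall>i\<in>{1..n}. norm (z i) \<le> 1" for z :: "nat \<Rightarrow> 'a"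
    proof -
      have zc: "restrict z {1..n} \<in> carrier ?L" by (simp add: carrier_linf_finite)
      then have "restrict z {1..n} \<in> vball ?L"
        using z n by (simp add: vball_def vnorm_linf_le del: One_nat_def)
      then have "vsetdist ?L (restrict z {1..n}) (Cset n m \<epsilon> \<alpha>) < ereal \<delta>"
        using m unfolding Dparam_def by (rule order_le_less_trans[OF SUP_upper])
      then have "convex_approx n m \<epsilon> \<alpha> \<delta> (restrict z {1..n})"
        using vsetdist_Cset_less[OF n zc] by simp
      then show ?thesis using convex_approx_cong[of n "restrict z {1..n}" z] by simp
    qed
    then show "\<exists>m. \<forall>z :: nat \<Rightarrow> 'a. (\<forall>i\<in>{1..n}. norm (z i) \<le> 1) \<longrightarrow> convex_approx n m \<epsilon> \<alpha> \<delta> z"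
      by blast
  qed
next
  let ?L = "linf {1..n} :: (nat \<Rightarrow> 'a) nspace"
  assume approx: "\<forall>\<delta>>0. \<exists>m. \<forall>z :: nat \<Rightarrow> 'a. (\<forall>i\<in>{1..n}. norm (z i) \<le> 1) \<longrightarrow> convex_approx n m \<epsilon> \<alpha> \<delta> z"
  show "(\<lambda>k. Dparam X n k \<epsilon> \<alpha>) \<longlonglongrightarrow> 0"
  proof (rule order_tendstoI)
    fix a :: ereal assume "a < 0"
    then show "\<forall>\<^sub>F k in sequentially. a < Dparam X n k \<epsilon> \<alpha>"
      using Dparam_nonneg[OF n, of X] by (intro always_eventually allI) (rule less_le_trans)
  next
    fix a :: ereal assume "0 < a"
    \<comment> \<open>A value strictly below \<open>a\<close> is needed: over all z the supremum of
      distances below \<delta> may equal \<delta>.\<close>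
    then obtain \<delta> where \<delta>: "0 < ereal \<delta>" "ereal \<delta> < a" using ereal_dense2 by blast
    from \<delta>(1) have "\<delta> > 0" by simp
    then obtain m where m: "\<And>z :: nat \<Rightarrow> 'a. \<forall>i\<in>{1..n}. norm (z i) \<le> 1 \<Longrightarrow> convex_approx n m \<epsilon> \<alpha> \<delta> z"
      using approx by blast
    have "Dparam X n k \<epsilon> \<alpha> \<le> ereal \<delta>" if "m \<le> k" for k
      unfolding Dparam_def
    proof (rule SUP_least)
      fix z assume z: "z \<in> vball ?L"
      then have "convex_approx n m \<epsilon> \<alpha> \<delta> z"
        using n by (intro m) (simp add: vball_def vnorm_linf_le del: One_nat_def)
      then have "convex_approx n k \<epsilon> \<alpha> \<delta> z" using that by (rule convex_approx_mono) simp
      then have "vsetdist ?L z (Cset n k \<epsilon> \<alpha>) < ereal \<delta>"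
        using vsetdist_Cset_less[OF n] z unfolding vball_def by blast
      then show "vsetdist ?L z (Cset n k \<epsilon> \<alpha>) \<le> ereal \<delta>" by (rule less_imp_le)
    qed
    then show "\<forall>\<^sub>F k in sequentially. Dparam X n k \<epsilon> \<alpha> < a"
      using \<delta>(2) unfolding eventually_sequentially by (meson order_le_less_trans)
  qed
qed


section \<open>From an ultrapower to the space\<close>

text \<open>Elements of the separating cone will be lists of weighted tuples, as concatenation and
  scaling of the weights realise the cone operations. Convex combinations are indexed from 1, hence
  the shift.\<close>

lemma sum_list_map_eq_sum: "sum_list (map f L) = (\<Sum>j\<in>{1..length L}. f (L ! (j - 1)))"
  by (simp add: sum_list_sum_nth atLeast0LessThan sum.atLeast1_atMost_eq)

context ultrafilter_on
begin

text \<open>Otherwise the constraints F (z - k) >= \<delta>, for all tuples k of the ball with large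
  sum, are compatible with the sum of the coordinate seminorms: a violated combination of them,
  divided by its total weight, would be a convex combination closer to z than \<delta>. The
  components of the resulting F then contradict \<open>slices_with_large_sum\<close> at the points z
  i.\<close>

lemma convex_combinations_dense:
  fixes z :: "nat \<Rightarrow> 'i \<Rightarrow> 'a::real_normed_vector"
  assumes large: "slices_with_large_sum TYPE('a)"
    and n: "n \<ge> 1" and \<epsilon>: "\<epsilon> > 0" and \<delta>: "\<delta> > 0" and z: "\<And>i. i \<in> {1..n} \<Longrightarrow> z i \<in> uball"
  shows "\<exists>(m::nat) c w. (\<forall>j\<in>{1..m}. c j \<ge> 0 \<and> (\<forall>i\<in>{1..n}. w j i \<in> uball) \<and>
        ultranorm (\<lambda>l. \<Sum>i\<in>{1..n}. w j i l) > real n * (1 - \<epsilon>)) \<and>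
     (\<Sum>j\<in>{1..m}. c j) = 1 \<and>
     (\<forall>i\<in>{1..n}. ultranorm (\<lambda>l. z i l - (\<Sum>j\<in>{1..m}. c j *\<^sub>R w j i l)) < \<delta>)"
    (is "\<exists>m c w. ?Q m c w")
proof (rule ccontr)
  assume none: "\<nexists>m c w. ?Q m c w"
  \<comment> \<open>A tuple of functions is uncurried into one function on pairs, the form to which
    \<open>hahn_banach_cone\<close> applies.\<close>
  define S :: "(nat \<times> 'i \<Rightarrow> 'a) set" where
    "S = {x. \<forall>i\<in>{1..n}. bounded ((\<lambda>l. x (i, l)) ` \<Lambda>)}"
  \<comment> \<open>This sum dominates each coordinate seminorm, and on tuples with a single nonzero
    coordinate it equals \<open>ultranorm\<close>; the latter gives each component of F the bound
    1.\<close>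
  define p where "p x = (\<Sum>i\<in>{1..n}. ultranorm (\<lambda>l. x (i, l)))" for x :: "nat \<times> 'i \<Rightarrow> 'a"
  define K :: "(nat \<Rightarrow> 'i \<Rightarrow> 'a) set" where
    "K = {k. (\<forall>i\<in>{1..n}. k i \<in> uball) \<and> ultranorm (\<lambda>l. \<Sum>i\<in>{1..n}. k i l) > real n * (1 - \<epsilon>)}"
  define D where "D = {L. \<forall>(t :: real, k)\<in>set L. t \<ge> 0 \<and> k \<in> K}"
  define wt :: "(real \<times> (nat \<Rightarrow> 'i \<Rightarrow> 'a)) list \<Rightarrow> real" where "wt L = sum_list (map fst L)" for L
  define pt where "pt L = (\<lambda>(i, l). if i \<in> {1..n} then sum_list (map (\<lambda>(t, k). t *\<^sub>R (z i l - k i l)) L) else 0)"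
    for L :: "(real \<times> (nat \<Rightarrow> 'i \<Rightarrow> 'a)) list"
  define C where "C = (\<lambda>L. (pt L, \<delta> * wt L)) ` D"

  have S: "fun_subspace S"
    unfolding fun_subspace_def S_def
    by (auto intro: bounded_image_add bounded_image_scale bounded_imageI[of _ 0])
  have p: "sublinear_on S p"
    unfolding sublinear_on_def
  proof (intro conjI ballI allI impI)
    fix x y assume "x \<in> S" "y \<in> S"
    then show "p (\<lambda>k. x k + y k) \<le> p x + p y"
      unfolding p_def sum.distrib[symmetric] by (intro sum_mono ultranorm_add) (auto simp: S_def)
  next
    fix c :: real and x assume "0 \<le> c" "x \<in> S"
    then show "p (\<lambda>k. c *\<^sub>R x k) = c * p x"
      unfolding p_def sum_distrib_left by (intro sum.cong) (auto simp: ultranorm_scale S_def)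
  qed
  have bz: "bounded (z i ` \<Lambda>)" if "i \<in> {1..n}" for i using z[OF that] by (rule uball_bounded)
  have bK: "bounded (k i ` \<Lambda>)" if "k \<in> K" "i \<in> {1..n}" for k i
    using that by (auto simp: K_def intro: uball_bounded)
  have pt_S: "pt L \<in> S" if L: "L \<in> D" for L
  proof -
    have "bounded ((\<lambda>l. pt L (i, l)) ` \<Lambda>)" if i: "i \<in> {1..n}" for i
    proof -
      have "bounded ((\<lambda>l. \<Sum>j\<in>{1..length L}. fst (L ! (j - 1)) *\<^sub>R (z i l - snd (L ! (j - 1)) i l)) ` \<Lambda>)"
      proof (intro bounded_image_sum bounded_image_scale bounded_image_diff bz[OF i] bK[OF _ i])
        fix j assume "j \<in> {1..length L}"
        then have "L ! (j - 1) \<in> set L" by auto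
        then show "snd (L ! (j - 1)) \<in> K" using L by (auto simp: D_def)
      qed
      then show ?thesis using i by (simp add: pt_def sum_list_map_eq_sum case_prod_beta)
    qed
    then show ?thesis by (simp add: S_def)
  qed
  have C: "fun_cone S C"
    unfolding fun_cone_def
  proof (intro conjI)
    show "C \<subseteq> S \<times> UNIV" using pt_S by (auto simp: C_def)
    have "((\<lambda>_. 0), 0) = (pt [], \<delta> * wt [])" by (auto simp: pt_def wt_def)
    then show "((\<lambda>_. 0), 0) \<in> C" by (auto simp: C_def D_def)
    have "((\<lambda>k. pt L k + pt M k), \<delta> * wt L + \<delta> * wt M) \<in> C" if "L \<in> D" "M \<in> D" for L M
    proof -
      have "L @ M \<in> D" using that by (auto simp: D_def)
      moreover have "((\<lambda>k. pt L k + pt M k), \<delta> * wt L + \<delta> * wt M) = (pt (L @ M), \<delta> * wt (L @ M))"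
        by (auto simp: pt_def wt_def algebra_simps)
      ultimately show ?thesis unfolding C_def by blast
    qed
    then show "\<forall>(x, r)\<in>C. \<forall>(y, s)\<in>C. ((\<lambda>k. x k + y k), r + s) \<in> C" by (auto simp: C_def)
    have "((\<lambda>k. c *\<^sub>R pt L k), c * (\<delta> * wt L)) \<in> C" if "L \<in> D" "c \<ge> 0" for L c
    proof -
      let ?M = "map (\<lambda>(t, k). (c * t, k)) L"
      have "?M \<in> D" using that by (auto simp: D_def)
      moreover have "wt ?M = c * wt L"
        by (simp add: wt_def sum_list_const_mult comp_def case_prod_beta)
      moreover have "sum_list (map (\<lambda>(t, k). t *\<^sub>R (z i l - k i l)) ?M) =
          c *\<^sub>R sum_list (map (\<lambda>(t, k). t *\<^sub>R (z i l - k i l)) L)" for i l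
        by (simp add: sum_list_map_eq_sum case_prod_beta scaleR_sum_right nth_map)
      then have "pt ?M = (\<lambda>k. c *\<^sub>R pt L k)"
        by (auto simp: pt_def fun_eq_iff)
      ultimately show ?thesis unfolding C_def by (intro image_eqI[of _ _ ?M]) auto
    qed
    then show "\<forall>c\<ge>0. \<forall>(x, r)\<in>C. ((\<lambda>k. c *\<^sub>R x k), c * r) \<in> C" by (auto simp: C_def)
  qed
  have le: "\<delta> * wt L \<le> p (pt L)" if L: "L \<in> D" for L
  proof (rule ccontr)
    assume less: "\<not> \<delta> * wt L \<le> p (pt L)"
    have b: "bounded ((\<lambda>l. pt L (i, l)) ` \<Lambda>)" if "i \<in> {1..n}" for i
      using pt_S[OF L] that by (simp add: S_def)
    have p_nonneg: "0 \<le> p (pt L)" unfolding p_def by (intro sum_nonneg ultranorm_nonneg b)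
    \<comment> \<open>As the seminorm is nonnegative, a violated constraint has positive total
      weight and can be normalised.\<close>
    then have "0 < \<delta> * wt L" using less by simp
    then have T: "0 < wt L" using \<delta> by (rule zero_less_mult_pos)
    define c where "c j = fst (L ! (j - 1)) / wt L" for j
    define w where "w j = snd (L ! (j - 1))" for j
    have "c j \<ge> 0 \<and> w j \<in> K" if "j \<in> {1..length L}" for j
    proof -
      have "L ! (j - 1) \<in> set L" using that by auto
      then show ?thesis using L T by (auto simp: D_def c_def w_def)
    qed
    moreover have c1: "(\<Sum>j\<in>{1..length L}. c j) = 1"
      using T by (simp add: c_def wt_def sum_list_map_eq_sum flip: sum_divide_distrib)
    moreover have "ultranorm (\<lambda>l. z i l - (\<Sum>j\<in>{1..length L}. c j *\<^sub>R w j i l)) < \<delta>"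
      if i: "i \<in> {1..n}" for i
    proof -
      have "z i l - (\<Sum>j\<in>{1..length L}. c j *\<^sub>R w j i l) = (1 / wt L) *\<^sub>R pt L (i, l)" for l
      proof -
        have "z i l - (\<Sum>j\<in>{1..length L}. c j *\<^sub>R w j i l) = (\<Sum>j\<in>{1..length L}. c j *\<^sub>R (z i l - w j i l))"
          using c1 by (simp add: scaleR_diff_right sum_subtractf flip: scaleR_sum_left)
        also have "\<dots> = (1 / wt L) *\<^sub>R pt L (i, l)"
          using i by (simp add: pt_def sum_list_map_eq_sum case_prod_beta scaleR_sum_right c_def w_def)
        finally show ?thesis .
      qed
      then have "ultranorm (\<lambda>l. z i l - (\<Sum>j\<in>{1..length L}. c j *\<^sub>R w j i l)) =
          (1 / wt L) * ultranorm (\<lambda>l. pt L (i, l))"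
        using T by (simp add: ultranorm_scale[OF b[OF i]])
      also have "\<dots> \<le> (1 / wt L) * p (pt L)"
        using T unfolding p_def by (intro mult_left_mono member_le_sum i ultranorm_nonneg b) auto
      also have "\<dots> < \<delta>" using less T by (simp add: field_simps)
      finally show ?thesis .
    qed
    ultimately have "?Q (length L) c w" by (auto simp: K_def)
    then show False using none by blast
  qed
  obtain F where F: "linear_on_funs S F" and Fp: "\<And>x. x \<in> S \<Longrightarrow> F x \<le> p x"
    and FC: "\<And>L. L \<in> D \<Longrightarrow> \<delta> * wt L \<le> F (pt L)"
    using hahn_banach_cone[OF S p C] le by (fastforce simp: C_def)

  \<comment> \<open>Placing f at position i and zero elsewhere isolates the i-th component of
    F.\<close>
  define em where "em i f = (\<lambda>(i', l). if i' = i then f l else 0)"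
    for i :: nat and f :: "'i \<Rightarrow> 'a"
  define \<phi> where "\<phi> i f = F (em i f)" for i f
  have em_S: "em i f \<in> S" if "bounded (f ` \<Lambda>)" for i f
    using that by (auto simp: em_def S_def intro: bounded_imageI[of _ 0])
  have p_em: "p (em i f) = ultranorm f" if "i \<in> {1..n}" for i f
  proof -
    have "p (em i f) = (\<Sum>k\<in>{1..n}. if k = i then ultranorm f else 0)"
      unfolding p_def by (rule sum.cong) (auto simp: em_def)
    then show ?thesis using that by simp
  qed
  have \<phi>_add: "\<phi> i (\<lambda>l. f l + g l) = \<phi> i f + \<phi> i g" if "bounded (f ` \<Lambda>)" "bounded (g ` \<Lambda>)" for i f g
  proof -
    have "em i (\<lambda>l. f l + g l) = (\<lambda>k. em i f k + em i g k)" by (auto simp: em_def)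
    then show ?thesis using linear_on_funs_add[OF F em_S[OF that(1)] em_S[OF that(2)]] by (simp add: \<phi>_def)
  qed
  have \<phi>_scale: "\<phi> i (\<lambda>l. c *\<^sub>R f l) = c * \<phi> i f" if "bounded (f ` \<Lambda>)" for i c f
  proof -
    have "em i (\<lambda>l. c *\<^sub>R f l) = (\<lambda>k. c *\<^sub>R em i f k)" by (auto simp: em_def)
    then show ?thesis using linear_on_funs_scale[OF F em_S[OF that]] by (simp add: \<phi>_def)
  qed
  have \<phi>: "ultrafunctional (\<phi> i)" if i: "i \<in> {1..n}" for i
  proof -
    have "\<bar>\<phi> i f\<bar> \<le> 1 * ultranorm f" if f: "bounded (f ` \<Lambda>)" for f
    proof -
      have "\<phi> i f \<le> ultranorm f" using Fp[OF em_S[OF f, of i]] p_em[OF i] by (simp add: \<phi>_def)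
      moreover have "\<phi> i (\<lambda>l. - f l) \<le> ultranorm (\<lambda>l. - f l)"
        using Fp[OF em_S[OF bounded_image_uminus[OF f], of i]] p_em[OF i] by (simp add: \<phi>_def)
      ultimately show ?thesis using \<phi>_scale[OF f, of i "-1"] by (simp add: ultranorm_uminus)
    qed
    then show ?thesis using \<phi>_add \<phi>_scale unfolding ultrafunctional_def by blast
  qed
  have F_sum: "F (\<lambda>(i, l). if i \<in> J then x i l else 0) = (\<Sum>i\<in>J. \<phi> i (x i))"
    if "finite J" "\<And>i. i \<in> J \<Longrightarrow> bounded (x i ` \<Lambda>)" for J x
    using that
  proof (induction J)
    case empty
    show ?case using linear_on_funs_scale[OF F fun_subspace_zero[OF S], of 0] by (simp add: case_prod_beta)
  next
    case (insert a J)
    let ?x = "\<lambda>(i, l). if i \<in> J then x i l else 0"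
    have "bounded ((\<lambda>l. ?x (i, l)) ` \<Lambda>)" for i
      using insert.prems by (cases "i \<in> J") (auto intro: bounded_imageI[of _ 0])
    then have "?x \<in> S" by (simp add: S_def)
    moreover have "(\<lambda>(i, l). if i \<in> insert a J then x i l else 0) = (\<lambda>k. em a (x a) k + ?x k)"
      using insert.hyps by (auto simp: em_def fun_eq_iff)
    ultimately show ?case
      using linear_on_funs_add[OF F em_S[of "x a" a] \<open>?x \<in> S\<close>] insert by (simp add: \<phi>_def)
  qed
  obtain w where w: "\<And>i. i \<in> {1..n} \<Longrightarrow> w i \<in> uball"
    and \<phi>_w: "(\<Sum>i\<in>{1..n}. \<phi> i (w i)) > (\<Sum>i\<in>{1..n}. \<phi> i (z i)) - \<delta>"
    and norm_w: "ultranorm (\<lambda>l. \<Sum>i\<in>{1..n}. w i l) > real n * (1 - \<epsilon>)"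
  proof -
    show thesis
      by (rule slices_with_large_sumE[OF large n \<delta> \<epsilon>, of \<phi> z]) (fact \<phi> z that)+
  qed
  have bw: "bounded (w i ` \<Lambda>)" if "i \<in> {1..n}" for i using w[OF that] by (rule uball_bounded)
  \<comment> \<open>The one-term list says that F (z - w) is at least \<delta>, whereas the choice
    of w makes it smaller.\<close>
  have "[(1, w)] \<in> D" using w norm_w by (simp add: D_def K_def)
  then have "\<delta> \<le> F (pt [(1, w)])" using FC[of "[(1, w)]"] by (simp add: wt_def)
  also have "\<dots> = F (\<lambda>(i, l). if i \<in> {1..n} then z i l - w i l else 0)" by (simp add: pt_def cong: if_cong)
  also have "\<dots> = (\<Sum>i\<in>{1..n}. \<phi> i (\<lambda>l. z i l - w i l))"
    using F_sum[of "{1..n}" "\<lambda>i l. z i l - w i l"] bounded_image_diff[OF bz bw] by simp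
  also have "\<dots> = (\<Sum>i\<in>{1..n}. \<phi> i (z i)) - (\<Sum>i\<in>{1..n}. \<phi> i (w i))"
    unfolding sum_subtractf[symmetric]
    by (intro sum.cong refl ultrafunctional_diff \<phi> bz bw)
  finally show False using \<phi>_w by simp
qed

text \<open>Given members B 0, B 1, ... with empty intersection, k l is the first index whose member
  misses l. On the intersection of the first m members k is at least m, so k tends to infinity along
  \<open>U\<close>.\<close>

lemma countably_incomplete_index:
  assumes "countably_incomplete_ultrafilter_over \<Lambda> U"
  shows "\<exists>k :: 'i \<Rightarrow> nat. \<forall>m. \<forall>\<^sub>F l in U. m \<le> k l"
proof -
  obtain \<A> where \<A>: "\<A> \<subseteq> filter_members \<Lambda> U" "countable \<A>" "\<Inter> \<A> = {}"
    using assms by (auto simp: countably_incomplete_ultrafilter_over_def)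
  then have "\<A> \<noteq> {}" by auto
  then obtain B :: "nat \<Rightarrow> 'i set" where B: "\<A> = range B"
    using \<A>(2) by (metis range_from_nat_into)
  define k where "k l = (LEAST m. l \<notin> B m)" for l
  have k: "l \<notin> B (k l)" for l
  proof -
    have "\<exists>m. l \<notin> B m" using \<A>(3) unfolding B by blast
    then show ?thesis unfolding k_def by (rule LeastI_ex)
  qed
  have "\<forall>\<^sub>F l in U. m \<le> k l" for m
  proof -
    have "\<forall>\<^sub>F l in U. l \<in> B j" for j using \<A>(1) by (auto simp: B filter_members_def)
    then have "\<forall>\<^sub>F l in U. \<forall>j\<in>{..<m}. l \<in> B j" by (simp add: eventually_ball_finite)
    then show ?thesis
    proof (rule eventually_mono)
      fix l assume "\<forall>j\<in>{..<m}. l \<in> B j"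
      then show "m \<le> k l" using k[of l] by (metis lessThan_iff not_le_imp_less)
    qed
  qed
  then show ?thesis by blast
qed

lemma SD2P_imp_convex_approx:
  assumes inc: "countably_incomplete_ultrafilter_over \<Lambda> U"
    and SD: "SD2P (ultrapower TYPE('a::real_normed_vector) \<Lambda> U)"
    and n: "n \<ge> 1" and \<epsilon>: "\<epsilon> > 0" and \<delta>: "\<delta> > 0"
  shows "\<exists>m. \<forall>z :: nat \<Rightarrow> 'a. (\<forall>i\<in>{1..n}. norm (z i) \<le> 1) \<longrightarrow> convex_approx n m \<epsilon> 1 \<delta> z"
proof (rule ccontr)
  assume "\<not> ?thesis"
  then have "\<forall>m. \<exists>z :: nat \<Rightarrow> 'a. (\<forall>i\<in>{1..n}. norm (z i) \<le> 1) \<and> \<not> convex_approx n m \<epsilon> 1 \<delta> z"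
    by blast
  then obtain Z :: "nat \<Rightarrow> nat \<Rightarrow> 'a" where Z: "\<And>m i. i \<in> {1..n} \<Longrightarrow> norm (Z m i) \<le> 1"
    and far: "\<And>m. \<not> convex_approx n m \<epsilon> 1 \<delta> (Z m)"
    by metis
  obtain k :: "'i \<Rightarrow> nat" where k: "\<And>m. \<forall>\<^sub>F l in U. m \<le> k l"
    using countably_incomplete_index[OF inc] by blast
  define z where "z i l = Z (k l) i" for i l
  have z: "z i \<in> uball" if "i \<in> {1..n}" for i using Z[OF that] by (simp add: z_def uball_def)
  obtain m :: nat and c w where c: "\<And>j. j \<in> {1..m} \<Longrightarrow> c j \<ge> (0::real)"
    and w: "\<And>j i. j \<in> {1..m} \<Longrightarrow> i \<in> {1..n} \<Longrightarrow> w j i \<in> uball"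
    and large: "\<And>j. j \<in> {1..m} \<Longrightarrow> ultranorm (\<lambda>l. \<Sum>i\<in>{1..n}. w j i l) > real n * (1 - \<epsilon>)"
    and c1: "(\<Sum>j\<in>{1..m}. c j) = 1"
    and close: "\<And>i. i \<in> {1..n} \<Longrightarrow> ultranorm (\<lambda>l. z i l - (\<Sum>j\<in>{1..m}. c j *\<^sub>R w j i l)) < \<delta>"
    using convex_combinations_dense[OF SD2P_imp_slices_with_large_sum[OF SD] n \<epsilon> \<delta>, of z] z by blast
  have bw: "bounded (w j i ` \<Lambda>)" if "j \<in> {1..m}" "i \<in> {1..n}" for j i
    using w[OF that] by (rule uball_bounded)
  have "\<forall>\<^sub>F l in U. \<forall>j\<in>{1..m}. norm (\<Sum>i\<in>{1..n}. w j i l) > real n * (1 - \<epsilon>)"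
    by (intro eventually_ball_finite ballI less_ultranorm large bounded_image_sum bw) auto
  moreover have "\<forall>\<^sub>F l in U. \<forall>i\<in>{1..n}. norm (z i l - (\<Sum>j\<in>{1..m}. c j *\<^sub>R w j i l)) < \<delta>"
    by (intro eventually_ball_finite ballI ultranorm_less close bounded_image_diff bounded_image_sum
        bounded_image_scale bw uball_bounded z) auto
  \<comment> \<open>Neither m nor the weights depend on l. Hence, as soon as m <= k l, the
    approximation of Z (k l) by m terms can be padded to k l terms, which Z was chosen to
    exclude.\<close>
  ultimately have "\<forall>\<^sub>F l in U. convex_approx n (k l) \<epsilon> 1 \<delta> (Z (k l))"
    using k[of m]
  proof eventually_elim
    case (elim l)
    have "convex_approx n m \<epsilon> 1 \<delta> (Z (k l))"
      unfolding convex_approx_def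
      using elim(1,2) c c1 w
      by (intro exI[of _ c] exI[of _ "\<lambda>j i. w j i l"]) (auto simp: z_def uball_def)
    then show ?case using elim(3) by (rule convex_approx_mono) simp
  qed
  then show False using far by (simp add: eventually_False)
qed


section \<open>From the space to an ultrapower\<close>

lemma convex_approx_imp_SD2P:
  assumes approx: "\<And>n \<epsilon> \<delta>. n \<ge> 1 \<Longrightarrow> \<epsilon> > 0 \<Longrightarrow> \<delta> > 0 \<Longrightarrow> \<exists>m. \<forall>z :: nat \<Rightarrow> 'a::real_normed_vector.
      (\<forall>i\<in>{1..n}. norm (z i) \<le> 1) \<longrightarrow> convex_approx n m \<epsilon> (1 + \<epsilon>) \<delta> z"
  shows "SD2P (ultrapower TYPE('a) \<Lambda> U)"
proof (rule slices_with_large_sum_imp_SD2P, unfold slices_with_large_sum_def, intro allI impI)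
  fix n :: nat and \<phi> :: "nat \<Rightarrow> ('i \<Rightarrow> 'a) \<Rightarrow> real" and y :: "nat \<Rightarrow> 'i \<Rightarrow> 'a" and \<alpha> \<epsilon> :: real
  assume n: "n \<ge> 1" and \<alpha>: "\<alpha> > 0" and \<epsilon>: "\<epsilon> > 0"
    and "\<forall>i\<in>{1..n}. ultrafunctional (\<phi> i) \<and> y i \<in> uball"
  then have \<phi>: "\<And>i. i \<in> {1..n} \<Longrightarrow> ultrafunctional (\<phi> i)" and y: "\<And>i. i \<in> {1..n} \<Longrightarrow> y i \<in> uball"
    by auto
  have "\<forall>i\<in>{1..n}. \<exists>K\<ge>0. \<forall>f. bounded (f ` \<Lambda>) \<longrightarrow> \<bar>\<phi> i f\<bar> \<le> K * ultranorm f"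
    using ultrafunctional_bound[OF \<phi>] by blast
  then obtain K where K: "\<And>i. i \<in> {1..n} \<Longrightarrow> K i \<ge> 0"
    "\<And>i f. i \<in> {1..n} \<Longrightarrow> bounded (f ` \<Lambda>) \<Longrightarrow> \<bar>\<phi> i f\<bar> \<le> K i * ultranorm f"
    by metis
  define T where "T = (\<Sum>i\<in>{1..n}. K i)"
  have T: "T \<ge> 0" unfolding T_def by (rule sum_nonneg) (rule K(1))
  \<comment> \<open>The bound \<epsilon> / 2 yields (1 + \<eta>) (1 - \<epsilon>) < 1 - \<eta>, so
    the sum stays large after division by 1 + \<eta>. The other bound yields 2 \<eta> T < \<alpha>:
    one \<eta> T pays for the approximation error under the functionals, one for the rescaling. T
    may be 0, hence T + 1.\<close>
  define \<eta> where "\<eta> = min (\<epsilon> / 2) (\<alpha> / (2 * (T + 1)))"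
  have \<eta>: "\<eta> > 0" "2 * \<eta> \<le> \<epsilon>" using \<alpha> \<epsilon> T by (auto simp: \<eta>_def)
  have \<eta>_T: "2 * \<eta> * T < \<alpha>"
  proof -
    have "\<eta> \<le> \<alpha> / (2 * (T + 1))" by (simp add: \<eta>_def)
    then have "2 * \<eta> * (T + 1) \<le> \<alpha>" using T by (simp add: pos_le_divide_eq mult_ac)
    then show ?thesis using \<eta> by (simp add: algebra_simps)
  qed
  obtain m where m: "\<And>z :: nat \<Rightarrow> 'a. \<forall>i\<in>{1..n}. norm (z i) \<le> 1 \<Longrightarrow> convex_approx n m \<eta> (1 + \<eta>) \<eta> z"
    using approx[OF n \<eta>(1) \<eta>(1)] by blast
  have approx_y: "convex_approx n m \<eta> (1 + \<eta>) \<eta> (\<lambda>i. y i l)" for l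
    using y by (intro m) (simp add: uball_def del: One_nat_def)
  define Q where "Q l c x \<longleftrightarrow> (\<forall>j\<in>{1..m}. c j \<ge> 0 \<and> (\<forall>i\<in>{1..n}. norm (x j i) \<le> 1 + \<eta>) \<and>
        norm (\<Sum>i\<in>{1..n}. x j i) > real n * (1 - \<eta>)) \<and>
     (\<Sum>j\<in>{1..m}. c j) = 1 \<and>
     (\<forall>i\<in>{1..n}. norm (y i l - (\<Sum>j\<in>{1..m}. c j *\<^sub>R x j i)) < \<eta>)" for l c x
  have "\<exists>c x. Q l c x" for l
    using approx_y[of l] by (simp only: convex_approx_def Q_def)
  then obtain c x where Q: "\<And>l. Q l (c l) (x l)"
    by metis
  have c: "c l j \<ge> 0" and large: "norm (\<Sum>i\<in>{1..n}. x l j i) > real n * (1 - \<eta>)" if "j \<in> {1..m}" for l j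
    using Q that by (simp_all only: Q_def)
  have x: "norm (x l j i) \<le> 1 + \<eta>" if "j \<in> {1..m}" "i \<in> {1..n}" for l j i
    using Q that by (simp only: Q_def)
  have c1: "(\<Sum>j\<in>{1..m}. c l j) = 1" for l
    using Q by (simp only: Q_def)
  have close: "norm (y i l - (\<Sum>j\<in>{1..m}. c l j *\<^sub>R x l j i)) < \<eta>" if "i \<in> {1..n}" for l i
    using Q that by (simp only: Q_def)
  define W where "W j i = (\<lambda>l. x l j i)" for j i
  have bW: "bounded (W j i ` \<Lambda>)" if "j \<in> {1..m}" "i \<in> {1..n}" for j i
    using x[OF that] by (auto simp: W_def intro: bounded_imageI[of _ "1 + \<eta>"])
  have by': "bounded (y i ` \<Lambda>)" if "i \<in> {1..n}" for i using y[OF that] by (rule uball_bounded)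

  \<comment> \<open>Nonnegative weights with sum 1 lie in the compact interval [0, 1]. As m does not
    depend on l, finitely many limits along \<open>U\<close> provide constant weights.\<close>
  have "\<exists>d\<in>{0..1}. ((\<lambda>l. c l j) \<longlongrightarrow> d) U" if j: "j \<in> {1..m}" for j
  proof (rule compact_limit)
    show "c l j \<in> {0..1}" for l
      using c j c1[of l] member_le_sum[of j "{1..m}" "c l"] by auto
  qed simp
  then have "\<forall>j\<in>{1..m}. \<exists>d. d \<ge> 0 \<and> ((\<lambda>l. c l j) \<longlongrightarrow> d) U" by force
  then obtain d where d: "\<And>j. j \<in> {1..m} \<Longrightarrow> d j \<ge> 0"
    and lim: "\<And>j. j \<in> {1..m} \<Longrightarrow> ((\<lambda>l. c l j) \<longlongrightarrow> d j) U"
    by metis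
  have d1: "(\<Sum>j\<in>{1..m}. d j) = 1"
  proof (rule tendsto_unique[OF nontrivial])
    show "((\<lambda>l. \<Sum>j\<in>{1..m}. c l j) \<longlongrightarrow> (\<Sum>j\<in>{1..m}. d j)) U" by (intro tendsto_sum lim)
    show "((\<lambda>l. \<Sum>j\<in>{1..m}. c l j) \<longlongrightarrow> 1) U" by (simp only: c1 tendsto_const)
  qed
  \<comment> \<open>Replacing the weights by their limits costs at most the sum of the terms
    \<open>\<bar>c l j - d j\<bar> * (1 + \<eta>)\<close>, which tends to zero.\<close>
  have close_d: "ultranorm (\<lambda>l. y i l - (\<Sum>j\<in>{1..m}. d j *\<^sub>R W j i l)) \<le> \<eta>" if i: "i \<in> {1..n}" for i
  proof (rule tendsto_le[OF nontrivial])
    have "((\<lambda>l. \<Sum>j\<in>{1..m}. \<bar>c l j - d j\<bar> * (1 + \<eta>)) \<longlongrightarrow> (\<Sum>j\<in>{1..m}. \<bar>d j - d j\<bar> * (1 + \<eta>))) U"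
      by (intro tendsto_intros lim)
    then show "((\<lambda>l. \<eta> + (\<Sum>j\<in>{1..m}. \<bar>c l j - d j\<bar> * (1 + \<eta>))) \<longlongrightarrow> \<eta>) U"
      using tendsto_add[OF tendsto_const[of \<eta>]] by fastforce
    show "((\<lambda>l. norm (y i l - (\<Sum>j\<in>{1..m}. d j *\<^sub>R W j i l))) \<longlongrightarrow>
        ultranorm (\<lambda>l. y i l - (\<Sum>j\<in>{1..m}. d j *\<^sub>R W j i l))) U"
      using i by (intro tendsto_ultranorm bounded_image_diff bounded_image_sum bounded_image_scale bW by')
    have "norm (y i l - (\<Sum>j\<in>{1..m}. d j *\<^sub>R W j i l)) \<le> \<eta> + (\<Sum>j\<in>{1..m}. \<bar>c l j - d j\<bar> * (1 + \<eta>))" for l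
    proof -
      have "y i l - (\<Sum>j\<in>{1..m}. d j *\<^sub>R W j i l) =
          (y i l - (\<Sum>j\<in>{1..m}. c l j *\<^sub>R x l j i)) + (\<Sum>j\<in>{1..m}. (c l j - d j) *\<^sub>R x l j i)"
        by (simp add: W_def scaleR_diff_left sum_subtractf)
      also have "norm \<dots> \<le> norm (y i l - (\<Sum>j\<in>{1..m}. c l j *\<^sub>R x l j i)) +
          norm (\<Sum>j\<in>{1..m}. (c l j - d j) *\<^sub>R x l j i)"
        by (rule norm_triangle_ineq)
      also have "\<dots> \<le> \<eta> + (\<Sum>j\<in>{1..m}. \<bar>c l j - d j\<bar> * (1 + \<eta>))"
        using close[OF i, of l] x[OF _ i, of _ l]
        by (intro add_mono order_trans[OF norm_sum sum_mono]) (auto simp: mult_left_mono)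
      finally show ?thesis .
    qed
    then show "\<forall>\<^sub>F l in U. norm (y i l - (\<Sum>j\<in>{1..m}. d j *\<^sub>R W j i l)) \<le>
        \<eta> + (\<Sum>j\<in>{1..m}. \<bar>c l j - d j\<bar> * (1 + \<eta>))" by simp
  qed
  have "\<phi> i (y i) - (\<Sum>j\<in>{1..m}. d j * \<phi> i (W j i)) \<le> K i * \<eta>" if i: "i \<in> {1..n}" for i
  proof -
    have b: "bounded ((\<lambda>l. \<Sum>j\<in>{1..m}. d j *\<^sub>R W j i l) ` \<Lambda>)"
      using i by (intro bounded_image_sum bounded_image_scale bW)
    have "\<phi> i (\<lambda>l. \<Sum>j\<in>{1..m}. d j *\<^sub>R W j i l) = (\<Sum>j\<in>{1..m}. \<phi> i (\<lambda>l. d j *\<^sub>R W j i l))"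
      using i by (intro ultrafunctional_sum \<phi> bounded_image_scale bW)
    also have "\<dots> = (\<Sum>j\<in>{1..m}. d j * \<phi> i (W j i))"
      using i by (intro sum.cong refl ultrafunctional_scale \<phi> bW)
    finally have "\<phi> i (y i) - (\<Sum>j\<in>{1..m}. d j * \<phi> i (W j i)) =
        \<phi> i (\<lambda>l. y i l - (\<Sum>j\<in>{1..m}. d j *\<^sub>R W j i l))"
      using ultrafunctional_diff[OF \<phi>[OF i] by'[OF i] b] by simp
    also have "\<dots> \<le> K i * ultranorm (\<lambda>l. y i l - (\<Sum>j\<in>{1..m}. d j *\<^sub>R W j i l))"
      using K(2)[OF i bounded_image_diff[OF by'[OF i] b]] by simp
    also have "\<dots> \<le> K i * \<eta>" by (rule mult_left_mono[OF close_d[OF i] K(1)[OF i]])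
    finally show ?thesis .
  qed
  then have "(\<Sum>i\<in>{1..n}. \<phi> i (y i) - (\<Sum>j\<in>{1..m}. d j * \<phi> i (W j i))) \<le> (\<Sum>i\<in>{1..n}. K i * \<eta>)"
    by (rule sum_mono)
  moreover have "(\<Sum>i\<in>{1..n}. \<Sum>j\<in>{1..m}. d j * \<phi> i (W j i)) = (\<Sum>j\<in>{1..m}. d j * (\<Sum>i\<in>{1..n}. \<phi> i (W j i)))"
    by (subst sum.swap) (simp add: sum_distrib_left)
  ultimately have avg: "(\<Sum>i\<in>{1..n}. \<phi> i (y i)) - T * \<eta> \<le> (\<Sum>j\<in>{1..m}. d j * (\<Sum>i\<in>{1..n}. \<phi> i (W j i)))"
    by (simp add: sum_subtractf T_def sum_distrib_right)
  \<comment> \<open>The average of the g j with weights d j is almost the desired value, so the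
    largest g j is at least as good; its tuple \<open>W j\<close> has a large sum at every index l,
    as all of them do.\<close>
  define g where "g j = (\<Sum>i\<in>{1..n}. \<phi> i (W j i))" for j
  have "m \<noteq> 0" using d1 by (intro notI) simp
  then have "g ` {1..m} \<noteq> {}" by simp
  then have "Max (g ` {1..m}) \<in> g ` {1..m}" by (intro Max_in) auto
  then obtain j where gj: "Max (g ` {1..m}) = g j" and j: "j \<in> {1..m}" by (rule imageE)
  have "(\<Sum>i\<in>{1..n}. \<phi> i (y i)) - T * \<eta> \<le> g j"
  proof -
    have "(\<Sum>k\<in>{1..m}. d k * g k) \<le> (\<Sum>k\<in>{1..m}. d k * g j)"
      using d unfolding gj[symmetric] by (intro sum_mono mult_left_mono Max_ge) auto
    also have "\<dots> = g j" using d1 by (simp flip: sum_distrib_right)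
    finally show ?thesis using avg by (simp add: g_def)
  qed
  \<comment> \<open>The entries of \<open>W j\<close> have norm up to 1 + \<eta>; the rescaling
    returns them to the ball.\<close>
  define w where "w i = (\<lambda>l. (1 / (1 + \<eta>)) *\<^sub>R W j i l)" for i
  have \<eta>1: "1 + \<eta> > 0" using \<eta> by simp
  have w: "w i \<in> uball" if "i \<in> {1..n}" for i
    using x[OF j that] \<eta>1 by (simp add: w_def W_def uball_def)
  have g_w: "g j = (1 + \<eta>) * (\<Sum>i\<in>{1..n}. \<phi> i (w i))"
  proof -
    have "\<phi> i (w i) = (1 / (1 + \<eta>)) * \<phi> i (W j i)" if "i \<in> {1..n}" for i
      unfolding w_def by (rule ultrafunctional_scale[OF \<phi>[OF that] bW[OF j that]])
    then have "(\<Sum>i\<in>{1..n}. \<phi> i (w i)) = (1 / (1 + \<eta>)) * g j"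
      unfolding g_def sum_distrib_left by (intro sum.cong) auto
    then show ?thesis using \<eta>1 by simp
  qed
  have "(\<Sum>i\<in>{1..n}. \<phi> i (w i)) \<le> T"
    unfolding T_def
  proof (rule sum_mono)
    fix i assume i: "i \<in> {1..n}"
    have "\<phi> i (w i) \<le> K i * ultranorm (w i)"
      using K(2)[OF i uball_bounded[OF w[OF i]]] by simp
    also have "\<dots> \<le> K i * 1" by (intro mult_left_mono uball_ultranorm w i K(1))
    finally show "\<phi> i (w i) \<le> K i" by simp
  qed
  then have "\<eta> * (\<Sum>i\<in>{1..n}. \<phi> i (w i)) \<le> \<eta> * T" using \<eta> by (intro mult_left_mono) auto
  then have "(\<Sum>i\<in>{1..n}. \<phi> i (w i)) > (\<Sum>i\<in>{1..n}. \<phi> i (y i)) - \<alpha>"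
    using \<open>(\<Sum>i\<in>{1..n}. \<phi> i (y i)) - T * \<eta> \<le> g j\<close> \<eta>_T g_w by (simp add: algebra_simps)
  moreover have "ultranorm (\<lambda>l. \<Sum>i\<in>{1..n}. w i l) > real n * (1 - \<epsilon>)"
  proof -
    have b: "bounded ((\<lambda>l. \<Sum>i\<in>{1..n}. W j i l) ` \<Lambda>)" by (intro bounded_image_sum bW j)
    have "real n * (1 - \<eta>) \<le> ultranorm (\<lambda>l. \<Sum>i\<in>{1..n}. W j i l)"
      using less_imp_le[OF large[OF j]] by (intro ultranorm_ge b) (simp add: W_def del: One_nat_def)
    also have "\<dots> = (1 + \<eta>) * ultranorm (\<lambda>l. \<Sum>i\<in>{1..n}. w i l)"
      using ultranorm_scale[OF b, of "1 / (1 + \<eta>)"] \<eta>1 by (simp add: w_def flip: scaleR_sum_right)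
    finally have "real n * (1 - \<eta>) \<le> (1 + \<eta>) * ultranorm (\<lambda>l. \<Sum>i\<in>{1..n}. w i l)" .
    moreover have "(1 + \<eta>) * (real n * (1 - \<epsilon>)) < real n * (1 - \<eta>)"
    proof -
      have "(1 + \<eta>) * (1 - \<epsilon>) \<le> (1 + \<eta>) * (1 - 2 * \<eta>)" using \<eta> \<eta>1 by (intro mult_left_mono) auto
      also have "\<dots> < 1 - \<eta>" using \<eta> by (simp add: algebra_simps)
      finally show ?thesis using n by (simp add: mult.left_commute)
    qed
    ultimately have "(1 + \<eta>) * (real n * (1 - \<epsilon>)) < (1 + \<eta>) * ultranorm (\<lambda>l. \<Sum>i\<in>{1..n}. w i l)"
      by simp
    then show ?thesis using \<eta>1 by simp
  qed
  ultimately show "\<exists>w. (\<forall>i\<in>{1..n}. w i \<in> uball) \<and>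
           (\<Sum>i\<in>{1..n}. \<phi> i (w i)) > (\<Sum>i\<in>{1..n}. \<phi> i (y i)) - \<alpha> \<and>
           ultranorm (\<lambda>l. \<Sum>i\<in>{1..n}. w i l) > real n * (1 - \<epsilon>)"
    using w by blast
qed

end

section \<open>Equivalence of the six conditions\<close>

lemma SD2P_ultrapower_imp_Dunit_tendsto:
  fixes X :: "'a::real_normed_vector itself"
  assumes ci: "countably_incomplete_ultrafilter_over \<Lambda> U"
    and SD: "SD2P (ultrapower X \<Lambda> U)" and n: "n \<ge> 1" and \<epsilon>: "\<epsilon> > 0"
  shows "(\<lambda>k. Dunit X n k \<epsilon>) \<longlonglongrightarrow> 0"
proof -
  interpret ultrafilter_on \<Lambda> U
    using ci by unfold_locales (simp add: countably_incomplete_ultrafilter_over_def)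
  \<comment> \<open>This passes from X to \<open>TYPE('a)\<close>, the form used inside the locale;
    both unfold to the same space.\<close>
  have "SD2P (ultrapower TYPE('a) \<Lambda> U)" using SD by (simp add: ultrapower_def)
  then show ?thesis
    unfolding Dunit_def Dparam_tendsto_0_iff[OF n]
    using SD2P_imp_convex_approx[OF ci _ n \<epsilon>] by blast
qed

text \<open>The larger radius admits more tuples, so every approximation remains valid.\<close>

lemma Dunit_tendsto_imp_Dplus_tendsto:
  fixes X :: "'a::real_normed_vector itself"
  assumes "(\<lambda>k. Dunit X n k \<epsilon>) \<longlonglongrightarrow> 0" and n: "n \<ge> 1" and \<epsilon>: "\<epsilon> > 0"
  shows "(\<lambda>k. Dplus X n k \<epsilon>) \<longlonglongrightarrow> 0"
proof -
  have "convex_approx n m \<epsilon> (1 + \<epsilon>) \<delta> z" if "convex_approx n m \<epsilon> 1 \<delta> z" for m \<delta> and z :: "nat \<Rightarrow> 'a"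
    using that by (rule convex_approx_mono) (use \<epsilon> in auto)
  then show ?thesis
    using assms(1) unfolding Dunit_def Dplus_def Dparam_tendsto_0_iff[OF n] by blast
qed

lemma Dplus_tendsto_imp_SD2P_ultrapower:
  fixes X :: "'a::real_normed_vector itself"
  assumes Dplus: "\<And>n \<epsilon>. n \<ge> 1 \<Longrightarrow> \<epsilon> > 0 \<Longrightarrow> (\<lambda>k. Dplus X n k \<epsilon>) \<longlonglongrightarrow> 0"
    and U: "ultrafilter_over \<Lambda> U"
  shows "SD2P (ultrapower X \<Lambda> U)"
proof -
  interpret ultrafilter_on \<Lambda> U using U by unfold_locales
  have "SD2P (ultrapower TYPE('a) \<Lambda> U)"
  proof (rule convex_approx_imp_SD2P)
    fix n :: nat and \<epsilon> \<delta> :: real assume n: "n \<ge> 1" and "\<epsilon> > 0" "\<delta> > 0"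
    then show "\<exists>m. \<forall>z :: nat \<Rightarrow> 'a. (\<forall>i\<in>{1..n}. norm (z i) \<le> 1) \<longrightarrow> convex_approx n m \<epsilon> (1 + \<epsilon>) \<delta> z"
      using Dplus[OF n] unfolding Dplus_def Dparam_tendsto_0_iff[OF n] by blast
  qed
  then show ?thesis by (simp add: ultrapower_def)
qed

text \<open>The sets in (3) and in (6) range over subsets of two independently chosen infinite
  types. On a finite type no ultrafilter is countably incomplete, so (3) would fail and (6) would
  hold vacuously.\<close>

theorem corollary3p8:
  fixes X :: "'a::banach itself"
  assumes "infinite (UNIV :: 'i set)" and "infinite (UNIV :: 'j set)"
  defines "P1 \<equiv> USD2P X"
    and "P2 \<equiv> \<exists>U. free_ultrafilter_over {1::nat..} U \<and> SD2P (ultrapower X {1..} U)"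
    and "P3 \<equiv> \<exists>(\<Lambda> :: 'i set) U. countably_incomplete_ultrafilter_over \<Lambda> U \<and>
                 SD2P (ultrapower X \<Lambda> U)"
    and "P4 \<equiv> \<forall>n\<ge>1. \<forall>\<epsilon>>0. (\<lambda>k. Dunit X n k \<epsilon>) \<longlonglongrightarrow> 0"
    and "P5 \<equiv> \<forall>n\<ge>1. \<forall>\<epsilon>>0. (\<lambda>k. Dplus X n k \<epsilon>) \<longlonglongrightarrow> 0"
    and "P6 \<equiv> \<forall>(\<Lambda> :: 'j set) U. countably_incomplete_ultrafilter_over \<Lambda> U \<longrightarrow>
                 SD2P (ultrapower X \<Lambda> U)"
  shows "(P1 \<longleftrightarrow> P2) \<and> (P1 \<longleftrightarrow> P3) \<and> (P1 \<longleftrightarrow> P4) \<and> (P1 \<longleftrightarrow> P5) \<and> (P1 \<longleftrightarrow> P6)"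
proof -
  have ci: "countably_incomplete_ultrafilter_over {1::nat..} U" if "free_ultrafilter_over {1::nat..} U" for U
    using that by (rule free_ultrafilter_over_imp_countably_incomplete) simp
  \<comment> \<open>P1, P2, P4 and P5 form a cycle; P3 and P6 are joined to it by implying P4 and
    following from P5.\<close>
  have "P1 \<Longrightarrow> P2"
    using ex_free_ultrafilter_over_nat unfolding P1_def P2_def USD2P_def by blast
  moreover have "P2 \<Longrightarrow> P4"
    using SD2P_ultrapower_imp_Dunit_tendsto ci unfolding P2_def P4_def by blast
  moreover have "P3 \<Longrightarrow> P4"
    using SD2P_ultrapower_imp_Dunit_tendsto unfolding P3_def P4_def by blast
  moreover have "P6 \<Longrightarrow> P4"
    using SD2P_ultrapower_imp_Dunit_tendsto ex_countably_incomplete_ultrafilter_over[OF assms(2)]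
    unfolding P6_def P4_def by blast
  moreover have "P4 \<Longrightarrow> P5"
    using Dunit_tendsto_imp_Dplus_tendsto unfolding P4_def P5_def by blast
  moreover have "P5 \<Longrightarrow> P1"
    using Dplus_tendsto_imp_SD2P_ultrapower
    unfolding P5_def P1_def USD2P_def free_ultrafilter_over_def by blast
  moreover have "P5 \<Longrightarrow> P3"
    using Dplus_tendsto_imp_SD2P_ultrapower ex_countably_incomplete_ultrafilter_over[OF assms(1)]
    unfolding P5_def P3_def countably_incomplete_ultrafilter_over_def by blast
  moreover have "P5 \<Longrightarrow> P6"
    using Dplus_tendsto_imp_SD2P_ultrapower
    unfolding P5_def P6_def countably_incomplete_ultrafilter_over_def by blast
  ultimately show ?thesis by blast
qed

end
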